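(* Let $g=1+\sum_{|\alpha|\ge1}b_\alpha Z_\alpha$ be a free holomorphic function in a neighborhood of the origin such that $b_\alpha>0$ and $$\sup_{\alpha\in\mathbb F_n^+}\frac{b_\alpha}{b_{g_i\alpha}}<\infty\quad\text{for every } i\in\{1,\ldots,n\},$$ and let ${\bf W}=(W_1,\ldots,W_n)$ be the weighted left creation operators associated with $g$. Assume that the following conditions hold. (i) There is $i\in\{1,\ldots,n\}$ such that $$\lim_{\gamma\to\infty}\left(\frac{b_{g_p\gamma}}{b_{g_ig_p\gamma}}-\frac{b_\gamma}{b_{g_p\gamma}}\right)=0,\qquad p\in\{1,\ldots,n\}.$$ (ii) The following limit exists and $$\lim_{\gamma\to\infty}\sum_{i=1}^n\frac{b_\gamma}{b_{g_i\gamma}}<\sup_{\gamma\in\mathbb F_n^+}\sum_{i=1}^n\frac{b_\gamma}{b_{g_i\gamma}}.$$ Then the $n$-tuple ${\bf W}=(W_1,\ldots,W_n)$ has the boundary property.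
   Context: Fix an integer $n\ge 1$ and an $n$-dimensional complex Hilbert space $H_n$ with orthonormal basis $e_1,\ldots,e_n$. The full Fock space is $F^2(H_n)=\bigoplus_{k\ge0}H_n^{\otimes k}$, $H_n^{\otimes 0}=\mathbb C1$; left creation operators: $S_i\varphi=e_i\otimes\varphi$. $\mathbb F_n^+$ is the unital free semigroup on generators $g_1,\ldots,g_n$ with identity $g_0$; $|\alpha|$ is the length of $\alpha$. For $\alpha=g_{i_1}\cdots g_{i_k}$ put $e_\alpha=e_{i_1}\otimes\cdots\otimes e_{i_k}$, $e_{g_0}=1$, $Z_\alpha=Z_{i_1}\cdots Z_{i_k}$. A formal power series $g=1+\sum_{|\alpha|\ge1}b_\alpha Z_\alpha$ (with $b_{g_0}=1$, $b_\alpha>0$) in noncommuting indeterminates is free holomorphic in a neighborhood of the origin if $\limsup_{k}(\sum_{|\alpha|=k}b_\alpha^2)^{1/2k}<\infty$. The weighted left creation operators associated with $g$ are $W_i=S_iD_i$ on $F^2(H_n)$, where $D_ie_\alpha=\sqrt{b_\alpha/b_{g_i\alpha}}\,e_\alpha$. $C^*({\bf W})$ is the $C^*$-algebra generated by $W_1,\ldots,W_n$ and the identity (it is irreducible). Limits $\gamma\to\infty$ are along $\mathbb F_n^+$ ordered first by length and then lexicographically (equivalently, as $|\gamma|\to\infty$). Given a unital $C^*$-algebra $\mathcal B$ and a linear subspace $\mathcal S\subset\mathcal B$ containing the identity with $\mathcal B=C^*(\mathcal S)$, an irreducible representation $\pi:\mathcal B\to B(\mathcal H)$ is a boundary representation for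 $\mathcal S$ if $\pi|_{\mathcal S}$ has a unique completely positive extension to $\mathcal B$, namely $\pi$ itself. ${\bf W}$ has the boundary property if the identity representation of $C^*({\bf W})$ is a boundary representation for $\mathrm{span}\{I,W_1,\ldots,W_n\}$. *)

theory Defs
  imports "HOL-Analysis.Analysis"
begin

section \<open>Complex vector spaces and complex Hilbert spaces\<close>

class scaleC =
  fixes scaleC :: "complex \<Rightarrow> 'a \<Rightarrow> 'a"  (infixr \<open>*\<^sub>C\<close> 75)

class complex_vector = scaleC + real_vector +
  assumes scaleC_add_right: "c *\<^sub>C (x + y) = c *\<^sub>C x + c *\<^sub>C y"
    and scaleC_add_left: "(c + d) *\<^sub>C x = c *\<^sub>C x + d *\<^sub>C x"
    and scaleC_scaleC [simp]: "c *\<^sub>C d *\<^sub>C x = (c * d) *\<^sub>C x"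
    and scaleR_eq_scaleC: "r *\<^sub>R x = complex_of_real r *\<^sub>C x"

lemma scaleC_one [simp]: "1 *\<^sub>C x = (x :: 'a :: complex_vector)"
  using scaleR_eq_scaleC [of 1 x] by simp

global_interpretation complex_vector: vector_space "scaleC :: complex \<Rightarrow> 'a \<Rightarrow> 'a :: complex_vector"
  defines csubspace_raw_def: csubspace = complex_vector.subspace
    and cspan_raw_def: cspan = complex_vector.span
  by unfold_locales (simp_all add: scaleC_add_right scaleC_add_left)

text \<open>The inner product is linear in its first argument.\<close>

class chilbert_space = complex_vector + banach +
  fixes cinner :: "'a \<Rightarrow> 'a \<Rightarrow> complex"
  assumes cinner_commute: "cinner x y = cnj (cinner y x)"
    and cinner_add_left: "cinner (x + y) z = cinner x z + cinner y z"
    and cinner_scaleC_left [simp]: "cinner (c *\<^sub>C x) y = c * cinner x y"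
    and norm_eq_sqrt_cinner: "norm x = sqrt (Re (cinner x x))"

context
  fixes x y z :: "'a :: chilbert_space"
begin

lemma cinner_add_right: "cinner x (y + z) = cinner x y + cinner x z"
  by (metis cinner_add_left cinner_commute complex_cnj_add)

lemma cinner_scaleC_right [simp]: "cinner x (c *\<^sub>C y) = cnj c * cinner x y"
  by (metis cinner_commute cinner_scaleC_left complex_cnj_mult)

lemma cinner_self: "cinner x x = complex_of_real ((norm x)\<^sup>2)"
proof -
  have "sqrt (Re (cinner x x)) \<ge> 0"
    using norm_ge_zero [of x] by (simp add: norm_eq_sqrt_cinner)
  hence "Re (cinner x x) = (norm x)\<^sup>2"
    by (simp add: norm_eq_sqrt_cinner)
  moreover have "Im (cinner x x) = 0"
    by (metis Im_complex_of_real Reals_cnj_iff cinner_commute complex_is_Real_iff)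
  ultimately show ?thesis
    by (simp add: complex_eq_iff)
qed

end

lemma norm_scaleC [simp]: "norm (c *\<^sub>C x) = cmod c * norm (x :: 'a :: chilbert_space)"
proof -
  have "complex_of_real ((norm (c *\<^sub>C x))\<^sup>2) = c * cnj c * complex_of_real ((norm x)\<^sup>2)"
    unfolding cinner_self [symmetric] by simp
  also have "\<dots> = complex_of_real ((cmod c * norm x)\<^sup>2)"
    by (simp add: complex_norm_square [of c, symmetric] power_mult_distrib)
  finally have "(norm (c *\<^sub>C x))\<^sup>2 = (cmod c * norm x)\<^sup>2"
    using of_real_eq_iff by blast
  thus ?thesis by simp
qed

lemma norm_add_power2:
  "(norm (x + y))\<^sup>2 = (norm x)\<^sup>2 + 2 * Re (cinner x y) + (norm (y :: 'a :: chilbert_space))\<^sup>2"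
proof -
  have "complex_of_real ((norm (x + y))\<^sup>2) = cinner x x + cinner x y + cnj (cinner x y) + cinner y y"
    unfolding cinner_self [symmetric] cinner_add_left cinner_add_right
    by (simp add: cinner_commute [symmetric])
  from arg_cong [OF this, of Re] show ?thesis by (simp add: cinner_self flip: of_real_power)
qed

lemma norm_sum_diff_power2:
  "(norm (x + y))\<^sup>2 + (norm (x - y))\<^sup>2 = 2 * (norm x)\<^sup>2 + 2 * (norm (y :: 'a :: chilbert_space))\<^sup>2"
proof -
  have "cinner x (- y) = - cinner x y"
    using cinner_scaleC_right [of x "-1" y] scaleR_eq_scaleC [of "-1" y] by simp
  thus ?thesis using norm_add_power2 [of x y] norm_add_power2 [of x "- y"] by simp
qed

lemma re_cinner_le: "Re (cinner x y) \<le> norm x * norm (y :: 'a :: chilbert_space)"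
proof -
  have "(norm (x + y))\<^sup>2 \<le> (norm x + norm y)\<^sup>2" by (intro power_mono norm_triangle_ineq) simp
  thus ?thesis by (simp add: norm_add_power2 power2_sum)
qed

lemma norm_cinner_le: "cmod (cinner x y) \<le> norm x * norm (y :: 'a :: chilbert_space)"
proof (cases "cinner x y = 0")
  case False
  define c where "c = cnj (cinner x y) / of_real (cmod (cinner x y))"
  have "c * cinner x y = of_real (cmod (cinner x y))"
    using False complex_norm_square [of "cinner x y"]
    by (simp add: c_def field_simps power2_eq_square)
  hence "Re (cinner (c *\<^sub>C x) y) = cmod (cinner x y)" by simp
  moreover have "cmod c = 1" using False by (simp add: c_def norm_divide)
  ultimately show ?thesis using re_cinner_le [of "c *\<^sub>C x" y] by simp
qed simp

lemma riesz_representation: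
  fixes f :: "'a :: chilbert_space \<Rightarrow> complex"
  assumes add: "\<And>x y. f (x + y) = f x + f y" and scale: "\<And>c x. f (c *\<^sub>C x) = c * f x"
    and bound: "\<And>x. cmod (f x) \<le> norm x * K"
  shows "\<exists>z. \<forall>x. f x = cinner x z"
proof -
  define J where "J x = (norm x)\<^sup>2 - 2 * Re (f x)" for x
  have J_ge: "J x \<ge> - K\<^sup>2" for x
  proof -
    have "Re (f x) \<le> norm x * K" using bound [of x] complex_Re_le_cmod [of "f x"] by linarith
    moreover have "0 \<le> (norm x - K)\<^sup>2" by simp
    ultimately show ?thesis unfolding J_def power2_diff by linarith
  qed
  define m where "m = Inf (range J)"
  have bdd: "bdd_below (range J)" by (rule bdd_belowI [of _ "- K\<^sup>2"]) (use J_ge in auto)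
  have m_le: "m \<le> J x" for x unfolding m_def by (rule cInf_lower [OF _ bdd]) simp
  have "\<exists>x. J x < m + 1 / real (Suc n)" for n
    using cInf_lessD [of "range J" "m + 1 / real (Suc n)"] by (auto simp: m_def)
  then obtain X where X: "\<And>n. J (X n) < m + 1 / real (Suc n)" by metis
  have scaleR: "f (r *\<^sub>R x) = of_real r * f x" for r x by (simp add: scaleR_eq_scaleC scale)
  have par: "(norm (x - y))\<^sup>2 \<le> 2 * J x + 2 * J y - 4 * m" for x y
  proof -
    have "4 * (norm ((1/2) *\<^sub>R (x + y)))\<^sup>2 = (norm (x + y))\<^sup>2"
      unfolding norm_scaleR by (simp add: power_divide)
    moreover have "Re (f ((1/2) *\<^sub>R (x + y))) = (Re (f x) + Re (f y)) / 2"
      unfolding scaleR add by simp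
    ultimately have "4 * J ((1/2) *\<^sub>R (x + y)) = (norm (x + y))\<^sup>2 - 4 * Re (f x) - 4 * Re (f y)"
      unfolding J_def by argo
    thus ?thesis using m_le [of "(1/2) *\<^sub>R (x + y)"] norm_sum_diff_power2 [of x y]
        J_def [of x] J_def [of y] by argo
  qed
  have "Cauchy X"
  proof (rule metric_CauchyI)
    fix e :: real assume e: "e > 0"
    obtain N where N: "4 / e\<^sup>2 < real N" using reals_Archimedean2 by blast
    have "dist (X i) (X j) < e" if "i \<ge> N" "j \<ge> N" for i j
    proof -
      have *: "1 / real (Suc k) < e\<^sup>2 / 4" if "k \<ge> N" for k
      proof -
        have "4 / e\<^sup>2 < real (Suc k)" using N that by linarith
        thus ?thesis using e by (simp add: field_simps)
      qed
      have "(norm (X i - X j))\<^sup>2 < e\<^sup>2"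
        using par [of "X i" "X j"] X [of i] X [of j] * [OF that(1)] * [OF that(2)] by linarith
      thus ?thesis using e by (simp add: dist_norm power2_less_imp_less)
    qed
    thus "\<exists>N. \<forall>i\<ge>N. \<forall>j\<ge>N. dist (X i) (X j) < e" by blast
  qed
  then obtain z where z: "X \<longlonglongrightarrow> z" by (auto simp: Cauchy_convergent_iff convergent_def)
  have "bounded_linear f"
    by (rule bounded_linear_intro [OF add _ bound]) (simp add: scaleR scaleR_conv_of_real)
  hence "(\<lambda>n. J (X n)) \<longlonglongrightarrow> J z"
    unfolding J_def by (intro tendsto_intros z bounded_linear.tendsto [of f])
  moreover have "(\<lambda>n. m + 1 / real (Suc n)) \<longlonglongrightarrow> m + 0"
    by (intro tendsto_intros LIMSEQ_Suc [OF lim_1_over_n])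
  ultimately have "J z \<le> m + 0"
    by (rule LIMSEQ_le) (use X less_imp_le in blast)
  hence Jz: "J z \<le> J x" for x using m_le [of x] by simp
  have re: "Re (cinner y z) = Re (f y)" for y
  proof -
    define a where "a = Re (cinner y z) - Re (f y)"
    have q: "0 \<le> 2 * t * a + t\<^sup>2 * (norm y)\<^sup>2" for t
    proof -
      have "J (t *\<^sub>R y + z) = J z + 2 * t * a + t\<^sup>2 * (norm y)\<^sup>2"
        using arg_cong [OF cinner_commute [of z y], of Re]
        by (simp add: J_def norm_add_power2 add scaleR scaleR_eq_scaleC scale a_def
            power_mult_distrib algebra_simps)
      thus ?thesis using Jz [of "t *\<^sub>R y + z"] by linarith
    qed
    define s where "s = (norm y)\<^sup>2 + 1"
    have s: "s > 0" "(norm y)\<^sup>2 < s * 1" by (auto simp: s_def add_nonneg_pos)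
    have "0 \<le> 2 * (- a / s) * a + (- a / s)\<^sup>2 * (norm y)\<^sup>2" by (rule q)
    also have "\<dots> \<le> 2 * (- a / s) * a + (- a / s)\<^sup>2 * s"
      using s by (intro add_left_mono mult_left_mono) auto
    also have "\<dots> = - (a\<^sup>2 / s)" using s by (simp add: field_simps power2_eq_square)
    finally have "a = 0" using s by (simp add: field_simps)
    thus ?thesis by (simp add: a_def)
  qed
  have "f x = cinner x z" for x
    using re [of x] re [of "\<i> *\<^sub>C x"] by (simp add: complex_eq_iff scale)
  thus ?thesis by blast
qed

lemma bounded_linear_scaleC: "bounded_linear (\<lambda>x. c *\<^sub>C (x :: 'a :: chilbert_space))"
  by (rule bounded_linear_intro [where K = "cmod c"])
     (simp_all add: scaleC_add_right scaleR_eq_scaleC mult.commute)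


section \<open>Bounded operators\<close>

instantiation blinfun :: (real_normed_vector, chilbert_space) complex_vector
begin

lift_definition scaleC_blinfun :: "complex \<Rightarrow> 'a \<Rightarrow>\<^sub>L 'b \<Rightarrow> 'a \<Rightarrow>\<^sub>L 'b" is
  "\<lambda>c f x. c *\<^sub>C f x"
  by (rule bounded_linear_compose [OF bounded_linear_scaleC])

instance
  by standard (simp_all add: blinfun_eqI scaleC_blinfun.rep_eq blinfun.add_left blinfun.scaleR_left
      scaleC_add_right scaleC_add_left scaleR_eq_scaleC)

end

text \<open>The type of \<open>'a \<Rightarrow>\<^sub>L 'b\<close> consists of bounded real-linear maps; the
  complex-linear ones are singled out by the following set.  For \<open>'a = 'b\<close> this is \<open>B(H)\<close>.\<close>

definition bounded_clinear_ops :: "('a::chilbert_space \<Rightarrow>\<^sub>L 'b::chilbert_space) set"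
  where "bounded_clinear_ops = {T. \<forall>c x. blinfun_apply T (c *\<^sub>C x) = c *\<^sub>C blinfun_apply T x}"

definition cadjoint :: "('a::chilbert_space \<Rightarrow>\<^sub>L 'b::chilbert_space) \<Rightarrow> 'b \<Rightarrow>\<^sub>L 'a"
  where "cadjoint T = (THE T'. \<forall>x y. cinner (blinfun_apply T x) y = cinner x (blinfun_apply T' y))"


lemma cinner_right_eqI:
  assumes "\<And>x. cinner x y = cinner x (z :: 'a :: chilbert_space)" shows "y = z"
proof -
  have "cinner (y - z) (y - z) + cinner (y - z) z = cinner (y - z) y"
    by (simp flip: cinner_add_right)
  with assms [of "y - z"] show ?thesis by (simp add: cinner_self)
qed

text \<open>The adjoint exists and is unique, so that the description in \<open>cadjoint_def\<close> denotes.\<close>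

lemma cinner_cadjoint:
  assumes T: "T \<in> bounded_clinear_ops"
  shows "cinner (blinfun_apply T x) y = cinner x (blinfun_apply (cadjoint T) y)"
proof -
  have "\<exists>z. \<forall>x. cinner (blinfun_apply T x) y = cinner x z" for y
  proof (rule riesz_representation [where K = "norm T * norm y"])
    show "cmod (cinner (blinfun_apply T x) y) \<le> norm x * (norm T * norm y)" for x
      using norm_cinner_le [of "blinfun_apply T x" y]
        mult_right_mono [OF norm_blinfun [of T x] norm_ge_zero [of y]]
      by (simp add: mult_ac)
  qed (use T in \<open>simp_all add: blinfun.add_right cinner_add_left bounded_clinear_ops_def\<close>)
  then obtain A where A: "\<And>x y. cinner (blinfun_apply T x) y = cinner x (A y)"
    by metis
  have "bounded_linear A"
  proof (rule bounded_linear_intro [where K = "norm T"])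
    show "A (y + y') = A y + A y'" for y y'
      by (rule cinner_right_eqI) (simp add: cinner_add_right flip: A)
    show "A (r *\<^sub>R y) = r *\<^sub>R A y" for r y
      by (rule cinner_right_eqI) (simp add: scaleR_eq_scaleC flip: A)
    show "norm (A y) \<le> norm y * norm T" for y
    proof (cases "A y = 0")
      case False
      have "(norm (A y))\<^sup>2 = cmod (cinner (blinfun_apply T (A y)) y)"
        by (simp add: A cinner_self norm_power)
      also have "\<dots> \<le> norm (blinfun_apply T (A y)) * norm y" by (rule norm_cinner_le)
      also have "\<dots> \<le> norm T * norm (A y) * norm y" by (intro mult_right_mono norm_blinfun) simp
      finally show ?thesis using False by (simp add: power2_eq_square mult_ac)
    qed simp
  qed
  hence A': "\<forall>x y. cinner (blinfun_apply T x) y = cinner x (blinfun_apply (Blinfun A) y)"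
    by (simp add: bounded_linear_Blinfun_apply A)
  have "\<forall>x y. cinner (blinfun_apply T x) y = cinner x (blinfun_apply (cadjoint T) y)"
    unfolding cadjoint_def
  proof (rule theI [where a = "Blinfun A"], rule A')
    fix T' assume T': "\<forall>x y. cinner (blinfun_apply T x) y = cinner x (blinfun_apply T' y)"
    show "T' = Blinfun A"
      by (intro blinfun_eqI cinner_right_eqI) (use A' T' in metis)
  qed
  thus ?thesis by blast
qed


section \<open>C*-algebras of operators, representations, completely positive maps\<close>

definition unital_cstar_algebra :: "('a::chilbert_space \<Rightarrow>\<^sub>L 'a) set \<Rightarrow> bool"
  where "unital_cstar_algebra B \<longleftrightarrow>
    B \<subseteq> bounded_clinear_ops \<and> csubspace B \<and> closed B \<and> id_blinfun \<in> B \<and>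
    (\<forall>S\<in>B. \<forall>T\<in>B. S o\<^sub>L T \<in> B) \<and> (\<forall>T\<in>B. cadjoint T \<in> B)"

definition cstar :: "('a::chilbert_space \<Rightarrow>\<^sub>L 'a) set \<Rightarrow> ('a \<Rightarrow>\<^sub>L 'a) set"
  where "cstar X = unital_cstar_algebra hull X"

definition linear_on_algebra ::
    "('a::chilbert_space \<Rightarrow>\<^sub>L 'a) set \<Rightarrow> (('a \<Rightarrow>\<^sub>L 'a) \<Rightarrow> ('b::chilbert_space \<Rightarrow>\<^sub>L 'b)) \<Rightarrow> bool"
  where "linear_on_algebra B \<phi> \<longleftrightarrow>
    \<phi> ` B \<subseteq> bounded_clinear_ops \<and>
    (\<forall>S\<in>B. \<forall>T\<in>B. \<phi> (S + T) = \<phi> S + \<phi> T) \<and> (\<forall>c. \<forall>T\<in>B. \<phi> (c *\<^sub>C T) = c *\<^sub>C \<phi> T)"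

definition star_representation ::
    "('a::chilbert_space \<Rightarrow>\<^sub>L 'a) set \<Rightarrow> (('a \<Rightarrow>\<^sub>L 'a) \<Rightarrow> ('b::chilbert_space \<Rightarrow>\<^sub>L 'b)) \<Rightarrow> bool"
  where "star_representation B \<pi> \<longleftrightarrow>
    linear_on_algebra B \<pi> \<and> \<pi> id_blinfun = id_blinfun \<and>
    (\<forall>S\<in>B. \<forall>T\<in>B. \<pi> (S o\<^sub>L T) = \<pi> S o\<^sub>L \<pi> T) \<and> (\<forall>T\<in>B. \<pi> (cadjoint T) = cadjoint (\<pi> T))"

definition irreducible_representation ::
    "('a::chilbert_space \<Rightarrow>\<^sub>L 'a) set \<Rightarrow> (('a \<Rightarrow>\<^sub>L 'a) \<Rightarrow> ('b::chilbert_space \<Rightarrow>\<^sub>L 'b)) \<Rightarrow> bool"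
  where "irreducible_representation B \<pi> \<longleftrightarrow>
    star_representation B \<pi> \<and> (UNIV :: 'b set) \<noteq> {0} \<and>
    (\<forall>M. csubspace M \<and> closed M \<and> (\<forall>T\<in>B. blinfun_apply (\<pi> T) ` M \<subseteq> M) \<longrightarrow> M = {0} \<or> M = UNIV)"

text \<open>An \<open>m \<times> m\<close> matrix of operators on \<open>H\<close> is positive if it is positive as an
  operator on the \<open>m\<close>-fold direct sum of \<open>H\<close>.\<close>

definition positive_matrix :: "nat \<Rightarrow> (nat \<Rightarrow> nat \<Rightarrow> ('a::chilbert_space \<Rightarrow>\<^sub>L 'a)) \<Rightarrow> bool"
  where "positive_matrix m A \<longleftrightarrow>
    (\<forall>x :: nat \<Rightarrow> 'a. (\<Sum>i<m. \<Sum>j<m. cinner (blinfun_apply (A i j) (x j)) (x i)) \<in> \<real>\<^sub>\<ge>\<^sub>0)"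

definition completely_positive ::
    "('a::chilbert_space \<Rightarrow>\<^sub>L 'a) set \<Rightarrow> (('a \<Rightarrow>\<^sub>L 'a) \<Rightarrow> ('b::chilbert_space \<Rightarrow>\<^sub>L 'b)) \<Rightarrow> bool"
  where "completely_positive B \<phi> \<longleftrightarrow>
    linear_on_algebra B \<phi> \<and>
    (\<forall>m A. (\<forall>i<m. \<forall>j<m. A i j \<in> B) \<and> positive_matrix m A \<longrightarrow> positive_matrix m (\<lambda>i j. \<phi> (A i j)))"

definition boundary_representation ::
    "('a::chilbert_space \<Rightarrow>\<^sub>L 'a) set \<Rightarrow> ('a \<Rightarrow>\<^sub>L 'a) set \<Rightarrow>
     (('a \<Rightarrow>\<^sub>L 'a) \<Rightarrow> ('b::chilbert_space \<Rightarrow>\<^sub>L 'b)) \<Rightarrow> bool"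
  where "boundary_representation B S \<pi> \<longleftrightarrow>
    unital_cstar_algebra B \<and> csubspace S \<and> id_blinfun \<in> S \<and> B = cstar S \<and>
    irreducible_representation B \<pi> \<and> completely_positive B \<pi> \<and>
    (\<forall>\<phi>. completely_positive B \<phi> \<and> (\<forall>T\<in>S. \<phi> T = \<pi> T) \<longrightarrow> (\<forall>T\<in>B. \<phi> T = \<pi> T))"

definition boundary_property :: "('i::finite \<Rightarrow> ('a::chilbert_space \<Rightarrow>\<^sub>L 'a)) \<Rightarrow> bool"
  where "boundary_property W \<longleftrightarrow>
    boundary_representation (cstar (range W)) (cspan (insert id_blinfun (range W))) (\<lambda>T. T)"


section \<open>The Hilbert space of square-summable families\<close>

typedef 'a ell2 = "{f :: 'a \<Rightarrow> complex. (\<lambda>x. (cmod (f x))\<^sup>2) summable_on UNIV}"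
  morphisms coord Abs_ell2
  by (rule exI [of _ "\<lambda>_. 0"]) simp

setup_lifting type_definition_ell2

lemma ell2_summable: "(\<lambda>x. (cmod (coord f x))\<^sup>2) summable_on UNIV"
  using coord [of f] by simp

lemma ell2_add:
  assumes "(\<lambda>x. (cmod (f x))\<^sup>2) summable_on UNIV" "(\<lambda>x. (cmod (g x))\<^sup>2) summable_on UNIV"
  shows "(\<lambda>x. (cmod (f x + g x))\<^sup>2) summable_on UNIV"
proof (rule summable_on_comparison_test)
  show "(\<lambda>x. 2 * (cmod (f x))\<^sup>2 + 2 * (cmod (g x))\<^sup>2) summable_on UNIV"
    by (intro summable_on_add summable_on_cmult_right assms)
  fix x
  have "(cmod (f x + g x))\<^sup>2 \<le> (cmod (f x) + cmod (g x))\<^sup>2"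
    by (intro power_mono norm_triangle_ineq) simp
  also have "\<dots> \<le> 2 * (cmod (f x))\<^sup>2 + 2 * (cmod (g x))\<^sup>2"
    using sum_squares_bound [of "cmod (f x)" "cmod (g x)"] by (simp add: power2_sum)
  finally show "(cmod (f x + g x))\<^sup>2 \<le> 2 * (cmod (f x))\<^sup>2 + 2 * (cmod (g x))\<^sup>2" .
qed simp

lemma ell2_scale:
  assumes "(\<lambda>x. (cmod (f x))\<^sup>2) summable_on UNIV"
  shows "(\<lambda>x. (cmod (c * f x))\<^sup>2) summable_on UNIV"
  using summable_on_cmult_right [OF assms, of "(cmod c)\<^sup>2"]
  by (simp add: norm_mult power_mult_distrib)

lemma ell2_prod_summable: "(\<lambda>x. coord f x * cnj (coord g x)) summable_on UNIV"
proof (rule abs_summable_summable, rule summable_on_comparison_test)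
  show "(\<lambda>x. (cmod (coord f x))\<^sup>2 + (cmod (coord g x))\<^sup>2) summable_on UNIV"
    by (intro summable_on_add ell2_summable)
  fix x
  have "2 * (cmod (coord f x) * cmod (coord g x)) \<le> (cmod (coord f x))\<^sup>2 + (cmod (coord g x))\<^sup>2"
    using sum_squares_bound [of "cmod (coord f x)" "cmod (coord g x)"] by (simp add: mult.assoc)
  moreover have "0 \<le> cmod (coord f x) * cmod (coord g x)" by simp
  ultimately show "norm (coord f x * cnj (coord g x)) \<le> (cmod (coord f x))\<^sup>2 + (cmod (coord g x))\<^sup>2"
    unfolding norm_mult complex_mod_cnj by linarith
qed simp

instantiation ell2 :: (type) complex_vector
begin

lift_definition zero_ell2 :: "'a ell2" is "\<lambda>_. 0" by simp
lift_definition plus_ell2 :: "'a ell2 \<Rightarrow> 'a ell2 \<Rightarrow> 'a ell2" is "\<lambda>f g x. f x + g x"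
  by (rule ell2_add)
lift_definition uminus_ell2 :: "'a ell2 \<Rightarrow> 'a ell2" is "\<lambda>f x. - f x" by simp
lift_definition minus_ell2 :: "'a ell2 \<Rightarrow> 'a ell2 \<Rightarrow> 'a ell2" is "\<lambda>f g x. f x - g x"
  using ell2_add [of _ "\<lambda>x. - g x" for g] by simp
lift_definition scaleR_ell2 :: "real \<Rightarrow> 'a ell2 \<Rightarrow> 'a ell2" is "\<lambda>r f x. of_real r * f x"
  by (rule ell2_scale)
lift_definition scaleC_ell2 :: "complex \<Rightarrow> 'a ell2 \<Rightarrow> 'a ell2" is "\<lambda>c f x. c * f x"
  by (rule ell2_scale)

instance
  by standard (transfer; force simp: algebra_simps)+

end

definition cinner_ell2' :: "'a ell2 \<Rightarrow> 'a ell2 \<Rightarrow> complex"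
  where "cinner_ell2' f g = (\<Sum>\<^sub>\<infinity>x. coord f x * cnj (coord g x))"

lemma cinner_ell2'_self: "cinner_ell2' f f = of_real (\<Sum>\<^sub>\<infinity>x. (cmod (coord f x))\<^sup>2)"
proof -
  have "cinner_ell2' f f = (\<Sum>\<^sub>\<infinity>x. of_real ((cmod (coord f x))\<^sup>2))"
    unfolding cinner_ell2'_def complex_norm_square by simp
  thus ?thesis
    by (simp only: infsumI [OF has_sum_of_real [OF has_sum_infsum [OF ell2_summable]]])
qed

instantiation ell2 :: (type) real_inner
begin

definition inner_ell2 :: "'a ell2 \<Rightarrow> 'a ell2 \<Rightarrow> real"
  where "inner_ell2 f g = Re (cinner_ell2' f g)"
definition norm_ell2 :: "'a ell2 \<Rightarrow> real"
  where "norm_ell2 f = sqrt (\<Sum>\<^sub>\<infinity>x. (cmod (coord f x))\<^sup>2)"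
definition dist_ell2 :: "'a ell2 \<Rightarrow> 'a ell2 \<Rightarrow> real"
  where "dist_ell2 f g = norm (f - g)"
definition sgn_ell2 :: "'a ell2 \<Rightarrow> 'a ell2"
  where "sgn_ell2 f = f /\<^sub>R norm f"
definition uniformity_ell2 :: "('a ell2 \<times> 'a ell2) filter"
  where "uniformity_ell2 = (INF e\<in>{0<..}. principal {(f, g). dist f g < e})"
definition open_ell2 :: "'a ell2 set \<Rightarrow> bool"
  where "open_ell2 U \<longleftrightarrow> (\<forall>f\<in>U. eventually (\<lambda>(f', g). f' = f \<longrightarrow> g \<in> U) uniformity)"

instance
proof
  fix f g h :: "'a ell2" and r :: real
  have "cinner_ell2' g f = cnj (cinner_ell2' f g)"
    unfolding cinner_ell2'_def infsum_cnj [symmetric] by (simp add: mult.commute)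
  thus "inner f g = inner g f" by (simp add: inner_ell2_def)
  have "cinner_ell2' (f + g) h = cinner_ell2' f h + cinner_ell2' g h"
    unfolding cinner_ell2'_def plus_ell2.rep_eq distrib_right
    by (rule infsum_add) (rule ell2_prod_summable)+
  thus "inner (f + g) h = inner f h + inner g h" by (simp add: inner_ell2_def)
  have "cinner_ell2' (r *\<^sub>R f) g = of_real r * cinner_ell2' f g"
    unfolding cinner_ell2'_def scaleR_ell2.rep_eq mult.assoc by (rule infsum_cmult_right')
  thus "inner (r *\<^sub>R f) g = r * inner f g" by (simp add: inner_ell2_def)
  show "0 \<le> inner f f"
    by (simp add: inner_ell2_def cinner_ell2'_self infsum_nonneg)
  show "inner f f = 0 \<longleftrightarrow> f = 0"
  proof
    assume "inner f f = 0"
    hence 0: "(\<Sum>\<^sub>\<infinity>x. (cmod (coord f x))\<^sup>2) = 0"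
      by (simp add: inner_ell2_def cinner_ell2'_self)
    have "(cmod (coord f x))\<^sup>2 = 0" for x
      by (rule nonneg_infsum_le_0D [OF _ ell2_summable]) (use 0 in auto)
    thus "f = 0"
      by (simp add: coord_inject [symmetric] zero_ell2.rep_eq fun_eq_iff)
  qed (simp add: inner_ell2_def cinner_ell2'_def zero_ell2.rep_eq)
  show "norm f = sqrt (inner f f)"
    by (simp add: inner_ell2_def cinner_ell2'_self norm_ell2_def)
qed (simp_all add: dist_ell2_def sgn_ell2_def uniformity_ell2_def open_ell2_def)

end

lemma norm_ell2_power2: "(norm f)\<^sup>2 = (\<Sum>\<^sub>\<infinity>x. (cmod (coord f x))\<^sup>2)"
  by (simp add: norm_ell2_def infsum_nonneg)

lemma sum_coord_le_norm:
  assumes "finite F" shows "(\<Sum>x\<in>F. (cmod (coord f x))\<^sup>2) \<le> (norm f)\<^sup>2"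
  unfolding norm_ell2_power2 by (rule finite_sum_le_infsum [OF ell2_summable assms]) auto

lemma coord_le_norm: "cmod (coord f x) \<le> norm f"
  using sum_coord_le_norm [of "{x}" f] by (simp add: power2_le_iff_abs_le)

lemma ell2_finite_sums_bound:
  assumes "\<And>F. finite F \<Longrightarrow> (\<Sum>x\<in>F. (cmod (h x))\<^sup>2) \<le> K\<^sup>2" "K \<ge> 0"
  shows "(\<lambda>x. (cmod (h x))\<^sup>2) summable_on UNIV" "norm (Abs_ell2 h) \<le> K"
proof -
  show s: "(\<lambda>x. (cmod (h x))\<^sup>2) summable_on UNIV"
    by (rule nonneg_bdd_above_summable_on) (auto intro!: bdd_aboveI [of _ "K\<^sup>2"] assms)
  have "(\<Sum>\<^sub>\<infinity>x. (cmod (h x))\<^sup>2) \<le> K\<^sup>2"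
    by (rule infsum_le_finite_sums [OF s]) (use assms in auto)
  hence "(norm (Abs_ell2 h))\<^sup>2 \<le> K\<^sup>2"
    using s by (simp add: norm_ell2_power2 Abs_ell2_inverse)
  thus "norm (Abs_ell2 h) \<le> K" using assms(2) by (simp add: power2_le_iff_abs_le)
qed

instance ell2 :: (type) complete_space
proof
  fix X :: "nat \<Rightarrow> 'a ell2"
  assume X: "Cauchy X"
  have "Cauchy (\<lambda>n. coord (X n) x)" for x
  proof (rule metric_CauchyI)
    fix e :: real assume "e > 0"
    then obtain N where "\<forall>m\<ge>N. \<forall>n\<ge>N. dist (X m) (X n) < e"
      using metric_CauchyD [OF X] by blast
    moreover have "dist (coord (X m) x) (coord (X n) x) \<le> dist (X m) (X n)" for m n
      using coord_le_norm [of "X m - X n" x] by (simp add: dist_norm minus_ell2.rep_eq)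
    ultimately show "\<exists>N. \<forall>m\<ge>N. \<forall>n\<ge>N. dist (coord (X m) x) (coord (X n) x) < e"
      using le_less_trans by blast
  qed
  hence "\<forall>x. \<exists>l. (\<lambda>n. coord (X n) x) \<longlonglongrightarrow> l"
    by (simp add: Cauchy_convergent_iff convergent_def)
  then obtain l where l: "\<And>x. (\<lambda>n. coord (X n) x) \<longlonglongrightarrow> l x"
    using choice [of "\<lambda>x l. (\<lambda>n. coord (X n) x) \<longlonglongrightarrow> l"] by blast
  have key: "(\<Sum>x\<in>F. (cmod (l x - coord (X n) x))\<^sup>2) \<le> e\<^sup>2"
    if N: "\<forall>m\<ge>N. \<forall>n\<ge>N. dist (X m) (X n) < e" and n: "n \<ge> N" and F: "finite F" for N n e F
  proof (rule tendsto_upperbound)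
    show "(\<lambda>m. \<Sum>x\<in>F. (cmod (coord (X m) x - coord (X n) x))\<^sup>2)
            \<longlonglongrightarrow> (\<Sum>x\<in>F. (cmod (l x - coord (X n) x))\<^sup>2)"
      by (intro tendsto_intros l)
    show "\<forall>\<^sub>F m in sequentially. (\<Sum>x\<in>F. (cmod (coord (X m) x - coord (X n) x))\<^sup>2) \<le> e\<^sup>2"
    proof (rule eventually_sequentiallyI [of N])
      fix m assume "m \<ge> N"
      hence "norm (X m - X n) < e" using N n by (simp add: dist_norm)
      hence "(norm (X m - X n))\<^sup>2 \<le> e\<^sup>2" by (intro power_mono) auto
      with sum_coord_le_norm [OF F, of "X m - X n"]
      show "(\<Sum>x\<in>F. (cmod (coord (X m) x - coord (X n) x))\<^sup>2) \<le> e\<^sup>2"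
        by (simp add: minus_ell2.rep_eq)
    qed
  qed simp
  have lim: "\<exists>L. coord L = l"
  proof -
    obtain N where N: "\<forall>m\<ge>N. \<forall>n\<ge>N. dist (X m) (X n) < 1"
      using metric_CauchyD [OF X, of 1] by auto
    have "(\<lambda>x. (cmod (l x - coord (X N) x))\<^sup>2) summable_on UNIV"
      by (rule ell2_finite_sums_bound(1) [of _ 1]) (use key [OF N, of N] in auto)
    from ell2_add [OF this ell2_summable [of "X N"]]
    show ?thesis by (intro exI [of _ "Abs_ell2 l"]) (simp add: Abs_ell2_inverse)
  qed
  then obtain L where L: "coord L = l" by blast
  have "X \<longlonglongrightarrow> L"
  proof (rule metric_LIMSEQ_I)
    fix e :: real assume "e > 0"
    then obtain N where N: "\<forall>m\<ge>N. \<forall>n\<ge>N. dist (X m) (X n) < e / 2"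
      using metric_CauchyD [OF X, of "e / 2"] by auto
    have "dist (X n) L < e" if "n \<ge> N" for n
    proof -
      have "norm (Abs_ell2 (coord (L - X n))) \<le> e / 2"
        by (rule ell2_finite_sums_bound(2))
           (use key [OF N that] \<open>e > 0\<close> in \<open>auto simp: minus_ell2.rep_eq L\<close>)
      thus ?thesis using \<open>e > 0\<close> by (simp add: dist_norm coord_inverse norm_minus_commute)
    qed
    thus "\<exists>N. \<forall>n\<ge>N. dist (X n) L < e" by blast
  qed
  thus "convergent X" by (auto simp: convergent_def)
qed

instantiation ell2 :: (type) chilbert_space
begin

definition cinner_ell2 :: "'a ell2 \<Rightarrow> 'a ell2 \<Rightarrow> complex"
  where "cinner f g = (\<Sum>\<^sub>\<infinity>x. coord f x * cnj (coord g x))"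

instance
proof
  fix f g h :: "'a ell2" and c :: complex
  show "cinner f g = cnj (cinner g f)"
    unfolding cinner_ell2_def infsum_cnj [symmetric] by (simp add: mult.commute)
  show "cinner (f + g) h = cinner f h + cinner g h"
    unfolding cinner_ell2_def plus_ell2.rep_eq distrib_right
    by (rule infsum_add) (rule ell2_prod_summable)+
  show "cinner (c *\<^sub>C f) g = c * cinner f g"
    unfolding cinner_ell2_def scaleC_ell2.rep_eq mult.assoc by (rule infsum_cmult_right')
  show "norm f = sqrt (Re (cinner f f))"
    using cinner_ell2'_self [of f]
    by (simp add: cinner_ell2_def cinner_ell2'_def norm_ell2_def)
qed

end

lift_definition ket :: "'a \<Rightarrow> 'a ell2" is "\<lambda>a x. if x = a then 1 else 0"
proof -
  fix a :: 'a
  have "finite {x. (cmod (if x = a then 1 else 0))\<^sup>2 \<noteq> 0}"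
    by (rule finite_subset [of _ "{a}"]) (auto split: if_splits)
  thus "(\<lambda>x. (cmod (if x = a then 1 else 0))\<^sup>2) summable_on UNIV"
    by (intro finite_nonzero_values_imp_summable_on) simp
qed


section \<open>The full Fock space and weighted left creation operators\<close>

text \<open>The letters of the free semigroup are the elements of a finite type \<open>'n\<close>, so that words
  are lists, \<open>g\<^sub>0\<close> is \<open>[]\<close> and \<open>g\<^sub>i\<alpha>\<close> is \<open>i # \<alpha>\<close>.  The tensor power of order \<open>k\<close> of the
  Hilbert space with orthonormal basis indexed by \<open>'n\<close> is the space of families indexed by
  the words of length \<open>k\<close>; the Hilbert sum over all \<open>k\<close> is the space of square-summable
  families indexed by all words, with \<open>e\<^sub>\<alpha> = ket \<alpha>\<close>.\<close>

type_synonym 'n fock = "'n list ell2"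

lift_definition left_creation_fun :: "'n \<Rightarrow> 'n fock \<Rightarrow> 'n fock" is
  "\<lambda>i \<phi> w. case w of [] \<Rightarrow> 0 | j # v \<Rightarrow> if j = i then \<phi> v else 0"
proof -
  fix i :: 'n and \<phi> :: "'n list \<Rightarrow> complex"
  let ?h = "\<lambda>w. case w of [] \<Rightarrow> 0 | j # v \<Rightarrow> if j = i then \<phi> v else 0"
  assume "(\<lambda>w. (cmod (\<phi> w))\<^sup>2) summable_on UNIV"
  hence "((\<lambda>w. (cmod (?h w))\<^sup>2) \<circ> (#) i) summable_on UNIV"
    by (simp add: o_def)
  hence "(\<lambda>w. (cmod (?h w))\<^sup>2) summable_on range ((#) i)"
    by (subst summable_on_reindex) (auto simp: o_def)
  thus "(\<lambda>w. (cmod (?h w))\<^sup>2) summable_on UNIV"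
    by (rule summable_on_cong_neutral [THEN iffD1, rotated -1]) (auto split: list.splits)
qed

lemma norm_left_creation_fun: "norm (left_creation_fun i \<phi>) = norm \<phi>"
proof -
  have "(\<Sum>\<^sub>\<infinity>w. (cmod (coord (left_creation_fun i \<phi>) w))\<^sup>2)
      = (\<Sum>\<^sub>\<infinity>w\<in>range ((#) i). (cmod (coord (left_creation_fun i \<phi>) w))\<^sup>2)"
    by (rule infsum_cong_neutral) (auto simp: left_creation_fun.rep_eq split: list.splits)
  also have "\<dots> = (\<Sum>\<^sub>\<infinity>w. (cmod (coord \<phi> w))\<^sup>2)"
    by (subst infsum_reindex) (auto simp: o_def left_creation_fun.rep_eq)
  finally show ?thesis by (simp add: norm_ell2_def)
qed

lift_definition left_creation :: "'n \<Rightarrow> 'n fock \<Rightarrow>\<^sub>L 'n fock" is left_creation_fun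
proof (rule bounded_linear_intro [where K = 1])
  fix i :: 'n and \<phi> \<psi> :: "'n fock" and r :: real
  show "left_creation_fun i (\<phi> + \<psi>) = left_creation_fun i \<phi> + left_creation_fun i \<psi>"
    by transfer (auto split: list.splits)
  show "left_creation_fun i (r *\<^sub>R \<phi>) = r *\<^sub>R left_creation_fun i \<phi>"
    by transfer (auto split: list.splits)
qed (simp add: norm_left_creation_fun)

lemma left_creation_ket: "left_creation i (ket \<alpha>) = ket (i # \<alpha>)"
  by (simp add: left_creation.rep_eq, transfer) (auto split: list.splits)

text \<open>The diagonal operator with entries \<open>d\<close>; unspecified if \<open>d\<close> is unbounded.\<close>

definition diag_op :: "('a \<Rightarrow> complex) \<Rightarrow> 'a ell2 \<Rightarrow>\<^sub>L 'a ell2"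
  where "diag_op d = Blinfun (\<lambda>\<phi>. Abs_ell2 (\<lambda>x. d x * coord \<phi> x))"

lemma coord_diag_op:
  assumes d: "bounded (range d)"
  shows "coord (diag_op d \<phi>) x = d x * coord \<phi> x"
proof -
  obtain K where K: "\<And>x. cmod (d x) \<le> K"
    using d by (auto simp: bounded_iff)
  hence K0: "K \<ge> 0" using norm_ge_zero order_trans by blast
  have fin: "(\<Sum>x\<in>F. (cmod (d x * coord \<psi> x))\<^sup>2) \<le> (norm \<psi> * K)\<^sup>2" if "finite F" for F \<psi>
  proof -
    have "(\<Sum>x\<in>F. (cmod (d x * coord \<psi> x))\<^sup>2) \<le> (\<Sum>x\<in>F. K\<^sup>2 * (cmod (coord \<psi> x))\<^sup>2)"
      by (intro sum_mono)
         (auto simp: norm_mult power_mult_distrib intro!: mult_right_mono power_mono K)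
    also have "\<dots> = K\<^sup>2 * (\<Sum>x\<in>F. (cmod (coord \<psi> x))\<^sup>2)" by (simp add: sum_distrib_left)
    also have "\<dots> \<le> K\<^sup>2 * (norm \<psi>)\<^sup>2" by (intro mult_left_mono sum_coord_le_norm that) simp
    finally show ?thesis by (simp add: power_mult_distrib mult.commute)
  qed
  have sm: "(\<lambda>x. (cmod (d x * coord \<psi> x))\<^sup>2) summable_on UNIV" for \<psi>
    by (rule ell2_finite_sums_bound(1) [OF fin]) (use K0 in auto)
  have co: "coord (Abs_ell2 (\<lambda>x. d x * coord \<psi> x)) = (\<lambda>x. d x * coord \<psi> x)" for \<psi>
    by (simp add: Abs_ell2_inverse sm)
  have "bounded_linear (\<lambda>\<phi>. Abs_ell2 (\<lambda>x. d x * coord \<phi> x))"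
  proof (rule bounded_linear_intro [where K = K])
    show "norm (Abs_ell2 (\<lambda>x. d x * coord \<psi> x)) \<le> norm \<psi> * K" for \<psi>
      by (rule ell2_finite_sums_bound(2) [OF fin]) (use K0 in auto)
    show "Abs_ell2 (\<lambda>x. d x * coord (\<psi> + \<psi>') x)
        = Abs_ell2 (\<lambda>x. d x * coord \<psi> x) + Abs_ell2 (\<lambda>x. d x * coord \<psi>' x)" for \<psi> \<psi>'
      by (rule coord_inject [THEN iffD1],
          simp only: plus_ell2.rep_eq [of "Abs_ell2 f" "Abs_ell2 g" for f g] co,
          simp only: plus_ell2.rep_eq distrib_left)
    show "Abs_ell2 (\<lambda>x. d x * coord (r *\<^sub>R \<psi>) x) = r *\<^sub>R Abs_ell2 (\<lambda>x. d x * coord \<psi> x)" for r \<psi>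
      by (rule coord_inject [THEN iffD1],
          simp only: scaleR_ell2.rep_eq [of _ "Abs_ell2 f" for f] co,
          simp only: scaleR_ell2.rep_eq mult.left_commute)
  qed
  thus ?thesis
    by (simp add: diag_op_def bounded_linear_Blinfun_apply Abs_ell2_inverse sm)
qed

definition free_holomorphic_at_0 :: "('n::finite list \<Rightarrow> real) \<Rightarrow> bool"
  where "free_holomorphic_at_0 b \<longleftrightarrow>
    limsup (\<lambda>k. ereal ((\<Sum>\<alpha> | length \<alpha> = k. (b \<alpha>)\<^sup>2) powr (1 / (2 * real k)))) < \<infinity>"

definition weighted_left_creation :: "('n list \<Rightarrow> real) \<Rightarrow> 'n \<Rightarrow> 'n fock \<Rightarrow>\<^sub>L 'n fock"
  where "weighted_left_creation b i =
    left_creation i o\<^sub>L diag_op (\<lambda>\<alpha>. complex_of_real (sqrt (b \<alpha> / b (i # \<alpha>))))"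

lemma weighted_left_creation_ket:
  assumes "\<And>\<alpha>. b \<alpha> > 0" and "bdd_above (range (\<lambda>\<alpha>. b \<alpha> / b (i # \<alpha>)))"
  shows "weighted_left_creation b i (ket \<alpha>) = complex_of_real (sqrt (b \<alpha> / b (i # \<alpha>))) *\<^sub>C ket (i # \<alpha>)"
proof -
  let ?d = "\<lambda>\<alpha>. complex_of_real (sqrt (b \<alpha> / b (i # \<alpha>)))"
  obtain K where K: "\<And>\<alpha>. b \<alpha> / b (i # \<alpha>) \<le> K"
    using assms(2) by (auto simp: bdd_above_def)
  have "cmod (?d \<alpha>) \<le> sqrt K" for \<alpha>
    using K [of \<alpha>] assms(1) [of \<alpha>] assms(1) [of "i # \<alpha>"] by (simp add: real_sqrt_le_iff del: real_sqrt_divide)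
  hence "bounded (range ?d)" unfolding bounded_iff by blast
  from coord_diag_op [OF this] have "diag_op ?d (ket \<alpha>) = ?d \<alpha> *\<^sub>C ket \<alpha>"
    by (simp add: coord_inject [symmetric] fun_eq_iff scaleC_ell2.rep_eq ket.rep_eq del: coord_inject)
  moreover have "left_creation i (c *\<^sub>C ket \<alpha>) = c *\<^sub>C left_creation i (ket \<alpha>)" for c
    by (simp add: left_creation.rep_eq, transfer) (auto split: list.splits)
  ultimately show ?thesis
    by (simp add: weighted_left_creation_def left_creation_ket)
qed

definition words_at_infinity :: "'n::finite list filter"
  where "words_at_infinity = filtercomap length at_top"

end

theory Submission
  imports Defs
begin

text \<open>Let \<open>\<phi>\<close> be a completely positive map on \<open>C\<^sup>*(W)\<close> that fixes \<open>I\<close> and the \<open>W\<^sub>i\<close>, with Stinespring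
  dilation \<open>\<phi>(a) = V\<^sup>* \<pi>(a) V\<close>. Call a finite set \<open>G\<close> of words localized if \<open>\<pi>(P\<^sub>G) V e\<^sub>\<gamma> = V e\<^sub>\<gamma>\<close> for
  all \<open>\<gamma> \<in> G\<close>. The operator \<open>\<Sum>\<^sub>i W\<^sub>i\<^sup>* W\<^sub>i\<close> is diagonal, and hypothesis (ii) makes its norm an isolated
  eigenvalue of finite multiplicity; by the Schwarz inequality its eigenspace gives a localized set.
  If \<open>a\<close> is \<open>W\<^sub>i\<close> or \<open>W\<^sub>i\<^sup>*\<close>, then on the words of a localized \<open>G\<close> where its weight is maximal
  \<open>\<phi>(a) = a\<close> attains the norm of \<open>a P\<^sub>G\<close>; hence \<open>\<pi>(a) V e\<^sub>\<gamma> = V a e\<^sub>\<gamma>\<close> there, and the set of these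
  words and its image under \<open>a\<close> are again localized. Removing letters with the \<open>W\<^sub>i\<^sup>*\<close> leads to the
  empty word, and adding letters with the \<open>W\<^sub>i\<close> shows that every single word is localized. So
  \<open>\<pi>(W\<^sub>i) V = V W\<^sub>i\<close> and \<open>\<pi>(W\<^sub>i\<^sup>*) V = V W\<^sub>i\<^sup>*\<close>, whence \<open>\<phi>\<close> is the identity. No dilation is actually
  constructed: \<open>\<pi>(a) V x = V y\<close> is expressed as \<open>\<phi>(b a) x = \<phi>(b) y\<close> for all \<open>b\<close>. For \<open>\<phi> = id\<close> the
  same argument puts the projections onto the basis vectors into \<open>C\<^sup>*(W)\<close>, which gives
  irreducibility.\<close>

section \<open>Operators on a complex Hilbert space\<close>

lemma cinner_zero_left [simp]: "cinner 0 (y :: 'a :: chilbert_space) = 0"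
  using cinner_add_left [of 0 0 y] by simp

lemma cinner_zero_right [simp]: "cinner (y :: 'a :: chilbert_space) 0 = 0"
  using cinner_add_right [of y 0 0] by simp

lemma cinner_minus_left [simp]: "cinner (- x) (y :: 'a :: chilbert_space) = - cinner x y"
  using cinner_add_left [of x "- x" y] by (simp add: eq_neg_iff_add_eq_0 add.commute)

lemma cinner_minus_right [simp]: "cinner y (- (x :: 'a :: chilbert_space)) = - cinner y x"
  using cinner_add_right [of y x "- x"] by (simp add: eq_neg_iff_add_eq_0 add.commute)

lemma cinner_diff_left: "cinner (x - z) (y :: 'a :: chilbert_space) = cinner x y - cinner z y"
  using cinner_add_left [of x "- z" y] by simp

lemma cinner_diff_right: "cinner (y :: 'a :: chilbert_space) (x - z) = cinner y x - cinner y z"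
  using cinner_add_right [of y x "- z"] by simp

lemma cinner_sum_left:
  "cinner (\<Sum>i\<in>I. f i) (y :: 'a :: chilbert_space) = (\<Sum>i\<in>I. cinner (f i) y)"
  by (induction I rule: infinite_finite_induct) (simp_all add: cinner_add_left)

lemma cinner_sum_right:
  "cinner (y :: 'a :: chilbert_space) (\<Sum>i\<in>I. f i) = (\<Sum>i\<in>I. cinner y (f i))"
  by (induction I rule: infinite_finite_induct) (simp_all add: cinner_add_right)

lemma cinner_left_eqI:
  assumes "\<And>x. cinner y x = cinner (z :: 'a :: chilbert_space) x" shows "y = z"
  by (rule cinner_right_eqI) (metis assms cinner_commute)

lemma blinfun_compose_id [simp]: "id_blinfun o\<^sub>L f = f" "f o\<^sub>L id_blinfun = f"
  by (rule blinfun_eqI, simp)+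

section \<open>Adjoints of complex-linear operators\<close>

lemma bounded_clinear_opsD:
  "T \<in> bounded_clinear_ops \<Longrightarrow> blinfun_apply T (c *\<^sub>C x) = c *\<^sub>C blinfun_apply T x"
  by (simp add: bounded_clinear_ops_def)

text \<open>The inner product separates points, so at most one operator satisfies the adjoint
  identity; exhibiting one evaluates the description in \<open>cadjoint\<close>.\<close>

lemma cadjoint_eqI:
  assumes "\<And>x y. cinner (blinfun_apply T x) y = cinner x (blinfun_apply T' y)"
  shows "cadjoint T = T'"
  unfolding cadjoint_def
proof (rule the_equality)
  show "R = T'" if "\<forall>x y. cinner (blinfun_apply T x) y = cinner x (blinfun_apply R y)" for R
    by (intro blinfun_eqI cinner_right_eqI) (metis assms that)
qed (use assms in blast)

lemma cinner_cadjoint_left: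
  assumes "T \<in> bounded_clinear_ops"
  shows "cinner (blinfun_apply (cadjoint T) x) y = cinner x (blinfun_apply T y)"
  by (metis assms cinner_cadjoint cinner_commute)

lemma cadjoint_in_bounded_clinear_ops:
  assumes "T \<in> bounded_clinear_ops" shows "cadjoint T \<in> bounded_clinear_ops"
  unfolding bounded_clinear_ops_def mem_Collect_eq
  by (intro allI cinner_left_eqI) (simp add: assms cinner_cadjoint_left)

lemma cadjoint_cadjoint:
  assumes "T \<in> bounded_clinear_ops" shows "cadjoint (cadjoint T) = T"
  by (rule cadjoint_eqI) (simp add: assms cinner_cadjoint_left)

lemma cadjoint_id: "cadjoint id_blinfun = id_blinfun"
  by (rule cadjoint_eqI) simp

lemma cadjoint_compose:
  assumes "S \<in> bounded_clinear_ops" "T \<in> bounded_clinear_ops"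
  shows "cadjoint (S o\<^sub>L T) = cadjoint T o\<^sub>L cadjoint S"
  by (rule cadjoint_eqI) (simp add: assms cinner_cadjoint)

lemma cadjoint_add:
  assumes "S \<in> bounded_clinear_ops" "T \<in> bounded_clinear_ops"
  shows "cadjoint (S + T) = cadjoint S + cadjoint T"
  by (rule cadjoint_eqI)
     (simp add: assms cinner_cadjoint blinfun.add_left cinner_add_left cinner_add_right)

lemma cadjoint_scaleC:
  assumes "T \<in> bounded_clinear_ops"
  shows "cadjoint (c *\<^sub>C T) = cnj c *\<^sub>C cadjoint T"
  by (rule cadjoint_eqI) (simp add: assms cinner_cadjoint scaleC_blinfun.rep_eq)

lemma cadjoint_diff:
  assumes "S \<in> bounded_clinear_ops" "T \<in> bounded_clinear_ops"
  shows "cadjoint (S - T) = cadjoint S - cadjoint T"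
  by (rule cadjoint_eqI)
     (simp add: assms cinner_cadjoint blinfun.diff_left cinner_diff_left cinner_diff_right)

lemma norm_cadjoint_le:
  assumes "T \<in> bounded_clinear_ops" shows "norm (cadjoint T) \<le> norm T"
proof (rule norm_blinfun_bound)
  fix y
  let ?z = "blinfun_apply (cadjoint T) y"
  show "norm ?z \<le> norm T * norm y"
  proof (cases "?z = 0")
    case False
    have "(norm ?z)\<^sup>2 = cmod (cinner (blinfun_apply T ?z) y)"
      by (simp add: cinner_cadjoint assms cinner_self norm_power)
    also have "\<dots> \<le> norm (blinfun_apply T ?z) * norm y" by (rule norm_cinner_le)
    also have "\<dots> \<le> norm T * norm ?z * norm y" by (intro mult_right_mono norm_blinfun) simp
    finally show ?thesis using False by (simp add: power2_eq_square mult_ac)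
  qed simp
qed simp

section \<open>The C*-algebra generated by a set of operators\<close>

lemma bounded_clinear_ops_csubspace: "csubspace bounded_clinear_ops"
  by (auto simp: complex_vector.subspace_def bounded_clinear_ops_def blinfun.add_left
      scaleC_blinfun.rep_eq scaleC_add_right mult.commute)

lemma bounded_clinear_ops_diff:
  "S \<in> bounded_clinear_ops \<Longrightarrow> T \<in> bounded_clinear_ops \<Longrightarrow> S - T \<in> bounded_clinear_ops"
  by (rule complex_vector.subspace_diff [OF bounded_clinear_ops_csubspace])

lemma tendsto_cadjoint:
  assumes "X \<longlonglongrightarrow> T" "\<And>n::nat. X n \<in> bounded_clinear_ops" "T \<in> bounded_clinear_ops"
  shows "(\<lambda>n. cadjoint (X n)) \<longlonglongrightarrow> cadjoint T"
proof (rule Lim_transform_bound [THEN LIM_zero_cancel])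
  show "(\<lambda>n. X n - T) \<longlonglongrightarrow> 0" using assms(1) by (rule LIM_zero)
  show "\<forall>\<^sub>F n in sequentially. norm (cadjoint (X n) - cadjoint T) \<le> norm (X n - T)"
    using norm_cadjoint_le [OF bounded_clinear_ops_diff [OF assms(2,3)]]
    by (simp add: cadjoint_diff assms)
qed

text \<open>Provides an ambient algebra, so that the hull in \<open>cstar\<close> is an intersection
  over a nonempty family. Closedness holds because norm limits are pointwise limits.\<close>

lemma unital_cstar_algebra_bounded_clinear_ops:
  "unital_cstar_algebra (bounded_clinear_ops :: ('a::chilbert_space \<Rightarrow>\<^sub>L 'a) set)"
proof -
  have "closed (bounded_clinear_ops :: ('a \<Rightarrow>\<^sub>L 'a) set)"
    unfolding closed_sequential_limits
  proof (intro allI impI)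
    fix X and T :: "'a \<Rightarrow>\<^sub>L 'a"
    assume X: "(\<forall>n. X n \<in> bounded_clinear_ops) \<and> X \<longlonglongrightarrow> T"
    have ap: "(\<lambda>n. blinfun_apply (X n) x) \<longlonglongrightarrow> blinfun_apply T x" for x
      using X by (intro blinfun.tendsto tendsto_const) simp
    have "blinfun_apply T (c *\<^sub>C x) = c *\<^sub>C blinfun_apply T x" for c x
    proof (rule LIMSEQ_unique [OF ap])
      show "(\<lambda>n. blinfun_apply (X n) (c *\<^sub>C x)) \<longlonglongrightarrow> c *\<^sub>C blinfun_apply T x"
        using bounded_linear.tendsto [OF bounded_linear_scaleC ap [of x], of c] X
        by (simp add: bounded_clinear_opsD)
    qed
    thus "T \<in> bounded_clinear_ops" by (simp add: bounded_clinear_ops_def)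
  qed
  thus ?thesis
    unfolding unital_cstar_algebra_def
    using bounded_clinear_ops_csubspace cadjoint_in_bounded_clinear_ops
    by (auto simp: bounded_clinear_ops_def)
qed

lemma unital_cstar_algebra_Inter:
  assumes "\<F> \<noteq> {}" "\<And>B. B \<in> \<F> \<Longrightarrow> unital_cstar_algebra B"
  shows "unital_cstar_algebra (\<Inter>\<F>)"
  unfolding unital_cstar_algebra_def
proof (intro conjI ballI)
  obtain B where "B \<in> \<F>" using assms(1) by blast
  with assms(2) show "\<Inter>\<F> \<subseteq> bounded_clinear_ops"
    by (meson Inter_lower order_trans unital_cstar_algebra_def)
  show "csubspace (\<Inter>\<F>)" "closed (\<Inter>\<F>)"
    by (intro complex_vector.subspace_Inter closed_Inter ballI;
        use assms(2) in \<open>simp add: unital_cstar_algebra_def\<close>)+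
qed (use assms(2) in \<open>simp_all add: unital_cstar_algebra_def\<close>)

lemma unital_cstar_algebra_cstar:
  assumes "X \<subseteq> bounded_clinear_ops" shows "unital_cstar_algebra (cstar X)"
  unfolding cstar_def hull_def
proof (rule unital_cstar_algebra_Inter)
  have "bounded_clinear_ops \<in> {B. unital_cstar_algebra B \<and> X \<subseteq> B}"
    using assms unital_cstar_algebra_bounded_clinear_ops by simp
  thus "{B. unital_cstar_algebra B \<and> X \<subseteq> B} \<noteq> {}" by (metis empty_iff)
qed simp

lemma subset_cstar: "X \<subseteq> cstar X"
  unfolding cstar_def by (rule hull_subset)

lemma cstar_minimal: "X \<subseteq> B \<Longrightarrow> unital_cstar_algebra B \<Longrightarrow> cstar X \<subseteq> B"
  unfolding cstar_def by (rule hull_minimal)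

text \<open>\<open>boundary_representation\<close> asks for the algebra generated by the operator
  space, \<open>boundary_property\<close> starts from the one generated by the operators. They
  coincide because every unital C*-algebra containing \<open>X\<close> contains the span.\<close>

lemma cstar_cspan_insert_id:
  assumes "X \<subseteq> bounded_clinear_ops"
  shows "cstar (cspan (insert id_blinfun X)) = cstar X"
proof
  let ?S = "cspan (insert id_blinfun X)"
  have span: "?S \<subseteq> B" if "unital_cstar_algebra B" "X \<subseteq> B" for B
    using that by (intro complex_vector.span_minimal) (simp_all add: unital_cstar_algebra_def)
  show "cstar ?S \<subseteq> cstar X"
    using unital_cstar_algebra_cstar [OF assms] by (intro cstar_minimal span subset_cstar)
  have "X \<subseteq> ?S" using complex_vector.span_superset [of "insert id_blinfun X"] by simp
  moreover have "unital_cstar_algebra (cstar ?S)"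
    by (intro unital_cstar_algebra_cstar span unital_cstar_algebra_bounded_clinear_ops assms)
  ultimately show "cstar X \<subseteq> cstar ?S"
    using subset_cstar [of ?S] by (intro cstar_minimal) simp_all
qed

section \<open>Unital completely positive maps\<close>

lemma cinner_self_nonneg: "cinner x (x :: 'a :: chilbert_space) \<in> \<real>\<^sub>\<ge>\<^sub>0"
  by (simp add: cinner_self)

text \<open>\<open>completely_positive\<close> provides only linearity and positivity of matrices.
  That \<phi> respects adjoints and is contractive is derived below with the help of
  \<open>unit\<close>.\<close>

locale unital_cp_map =
  fixes B :: "('a::chilbert_space \<Rightarrow>\<^sub>L 'a) set" and \<phi> :: "('a \<Rightarrow>\<^sub>L 'a) \<Rightarrow> ('b::chilbert_space \<Rightarrow>\<^sub>L 'b)"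
  assumes cstar: "unital_cstar_algebra B" and cp: "completely_positive B \<phi>"
    and unit: "\<phi> id_blinfun = id_blinfun"
begin

lemma bounded_clinear: "a \<in> B \<Longrightarrow> a \<in> bounded_clinear_ops"
  using cstar by (auto simp: unital_cstar_algebra_def)

lemma subspace: "csubspace B"
  using cstar by (simp add: unital_cstar_algebra_def)

lemmas add = complex_vector.subspace_add [OF subspace]
  and diff = complex_vector.subspace_diff [OF subspace]
  and sum = complex_vector.subspace_sum [OF subspace]
  and scaleC = complex_vector.subspace_scale [OF subspace]

lemma id: "id_blinfun \<in> B"
  and compose: "a \<in> B \<Longrightarrow> b \<in> B \<Longrightarrow> a o\<^sub>L b \<in> B"
  and adjoint: "a \<in> B \<Longrightarrow> cadjoint a \<in> B"
  and limit: "X \<longlonglongrightarrow> a \<Longrightarrow> (\<And>n::nat. X n \<in> B) \<Longrightarrow> a \<in> B"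
  using cstar closed_sequentially [of B X a] by (auto simp: unital_cstar_algebra_def)

lemma phi_add: "a \<in> B \<Longrightarrow> b \<in> B \<Longrightarrow> \<phi> (a + b) = \<phi> a + \<phi> b"
  and phi_scaleC: "a \<in> B \<Longrightarrow> \<phi> (c *\<^sub>C a) = c *\<^sub>C \<phi> a"
  and phi_bounded_clinear: "a \<in> B \<Longrightarrow> \<phi> a \<in> bounded_clinear_ops"
  using cp by (auto simp: completely_positive_def linear_on_algebra_def)

lemma phi_diff: "a \<in> B \<Longrightarrow> b \<in> B \<Longrightarrow> \<phi> (a - b) = \<phi> a - \<phi> b"
  using phi_add [of "a - b" b] by (simp add: diff)

lemma phi_sum: "finite I \<Longrightarrow> I \<noteq> {} \<Longrightarrow> (\<And>i. i \<in> I \<Longrightarrow> f i \<in> B) \<Longrightarrow>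
    \<phi> (\<Sum>i\<in>I. f i) = (\<Sum>i\<in>I. \<phi> (f i))"
  by (induction I rule: finite_ne_induct) (simp_all add: phi_add sum)

lemma phi_positive_matrix:
  "(\<And>i j. i < m \<Longrightarrow> j < m \<Longrightarrow> A i j \<in> B) \<Longrightarrow> positive_matrix m A \<Longrightarrow> positive_matrix m (\<lambda>i j. \<phi> (A i j))"
  using cp by (simp add: completely_positive_def)

text \<open>The entries \<open>cadjoint (c i) o\<^sub>L c j\<close> form a Gram matrix, which is
  positive. After applying \<phi>, the form is the squared norm of a vector in the Stinespring
  space; it is the substitute for the dilation.\<close>

lemma form_nonneg:
  fixes m :: nat
  assumes c: "\<And>i. i < m \<Longrightarrow> c i \<in> B"
  shows "(\<Sum>i<m. \<Sum>j<m. cinner (blinfun_apply (\<phi> (cadjoint (c i) o\<^sub>L c j)) (x j)) (x i)) \<in> \<real>\<^sub>\<ge>\<^sub>0"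
proof -
  have "positive_matrix m (\<lambda>i j. cadjoint (c i) o\<^sub>L c j)"
    unfolding positive_matrix_def
  proof
    fix x :: "nat \<Rightarrow> 'a"
    have "(\<Sum>i<m. \<Sum>j<m. cinner (blinfun_apply (cadjoint (c i) o\<^sub>L c j) (x j)) (x i))
        = cinner (\<Sum>j<m. blinfun_apply (c j) (x j)) (\<Sum>i<m. blinfun_apply (c i) (x i))"
      unfolding cinner_sum_left cinner_sum_right
      by (simp add: cinner_cadjoint_left bounded_clinear c)
    thus "(\<Sum>i<m. \<Sum>j<m. cinner (blinfun_apply (cadjoint (c i) o\<^sub>L c j) (x j)) (x i)) \<in> \<real>\<^sub>\<ge>\<^sub>0"
      using cinner_self_nonneg by simp
  qed
  hence "positive_matrix m (\<lambda>i j. \<phi> (cadjoint (c i) o\<^sub>L c j))"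
    by (rule phi_positive_matrix [rotated]) (simp add: compose adjoint c)
  thus ?thesis by (simp add: positive_matrix_def)
qed

lemma phi_nonneg:
  assumes a: "a \<in> B" and nonneg: "\<And>x. cinner (blinfun_apply a x) x \<in> \<real>\<^sub>\<ge>\<^sub>0"
  shows "cinner (blinfun_apply (\<phi> a) x) x \<in> \<real>\<^sub>\<ge>\<^sub>0"
proof -
  have "positive_matrix 1 (\<lambda>i j. a)" using nonneg by (simp add: positive_matrix_def)
  hence "positive_matrix 1 (\<lambda>i j. \<phi> a)"
    by (rule phi_positive_matrix [rotated]) (rule a)
  thus ?thesis by (auto simp: positive_matrix_def dest: spec [of _ "\<lambda>_. x"])
qed

text \<open>In dilation terms this is the squared norm of \<open>\<pi>(a) V x + V y\<close>. The
  \<open>case_nat\<close> family encodes the pair of \<open>a\<close> and the identity.\<close>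

lemma form2_nonneg:
  assumes "a \<in> B"
  shows "cinner (blinfun_apply (\<phi> (cadjoint a o\<^sub>L a)) x) x + cinner (blinfun_apply (\<phi> (cadjoint a)) y) x
      + (cinner (blinfun_apply (\<phi> a) x) y + cinner y y) \<in> \<real>\<^sub>\<ge>\<^sub>0"
proof -
  have "case_nat a (\<lambda>_. id_blinfun) i \<in> B" for i
    using assms id by (simp split: nat.split)
  from form_nonneg [of 2 "case_nat a (\<lambda>_. id_blinfun)" "case_nat x (\<lambda>_. y)", OF this]
  show ?thesis
    by (simp add: eval_nat_numeral cadjoint_id unit)
qed

text \<open>A nonnegative form is real. Replacing \<open>y\<close> by \<open>s *\<^sub>C y\<close>
  and comparing imaginary parts for \<open>s\<close> equal to 0, 1 and \<i> leaves only
  \<open>?p = cnj ?q\<close>.\<close>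

lemma cinner_phi_cadjoint:
  assumes "a \<in> B"
  shows "cinner (blinfun_apply (\<phi> (cadjoint a)) y) x = cinner y (blinfun_apply (\<phi> a) x)"
proof -
  let ?p = "cinner (blinfun_apply (\<phi> (cadjoint a)) y) x" and ?q = "cinner (blinfun_apply (\<phi> a) x) y"
  let ?r = "cinner (blinfun_apply (\<phi> (cadjoint a o\<^sub>L a)) x) x"
  have s: "?r + s * ?p + (cnj s * ?q + cnj s * (s * cinner y y)) \<in> \<real>\<^sub>\<ge>\<^sub>0" for s
    using form2_nonneg [OF assms, of x "s *\<^sub>C y"]
    by (simp add: bounded_clinear_opsD phi_bounded_clinear adjoint assms)
  have "Im ?r = 0" using s [of 0] by (simp add: complex_nonneg_Reals_iff)
  moreover have "Im (?r + ?p + (?q + cinner y y)) = 0"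
    using s [of 1] by (simp add: complex_nonneg_Reals_iff)
  moreover have "Im (?r + \<i> * ?p + (- \<i> * ?q + cinner y y)) = 0"
    using s [of \<i>] by (simp add: complex_nonneg_Reals_iff)
  ultimately have "?p = cnj ?q" by (simp add: complex_eq_iff cinner_self)
  thus ?thesis by (metis cinner_commute)
qed

text \<open>Expands the nonnegativity of the squared norm of \<open>\<pi>(a) V x - V y\<close>. With
  \<open>\<phi>(a) x\<close> for \<open>y\<close> it becomes the Kadison-Schwarz inequality.\<close>

lemma schwarz_defect_nonneg:
  assumes "a \<in> B"
  shows "2 * Re (cinner (blinfun_apply (\<phi> a) x) y)
      \<le> Re (cinner (blinfun_apply (\<phi> (cadjoint a o\<^sub>L a)) x) x) + (norm y)\<^sup>2"
proof -
  have "Re (cinner y (blinfun_apply (\<phi> a) x)) = Re (cinner (blinfun_apply (\<phi> a) x) y)"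
    by (subst cinner_commute) simp
  thus ?thesis
    using form2_nonneg [OF assms, of x "- y"]
    by (simp add: complex_nonneg_Reals_iff cinner_phi_cadjoint assms cinner_self blinfun.minus_right)
qed

lemma norm_phi_le:
  assumes a: "a \<in> B"
  shows "norm (\<phi> a) \<le> norm a"
proof (rule norm_blinfun_bound)
  fix x
  let ?K = "complex_of_real ((norm a)\<^sup>2)"
  have aa: "cadjoint a o\<^sub>L a \<in> B" by (intro compose adjoint a)
  have "cinner (blinfun_apply (\<phi> (?K *\<^sub>C id_blinfun - (cadjoint a o\<^sub>L a))) x) x \<in> \<real>\<^sub>\<ge>\<^sub>0"
  proof (rule phi_nonneg)
    fix z
    have "(norm (blinfun_apply a z))\<^sup>2 \<le> (norm a * norm z)\<^sup>2"
      by (intro power_mono norm_blinfun norm_ge_zero)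
    moreover have "cinner (blinfun_apply (?K *\<^sub>C id_blinfun - (cadjoint a o\<^sub>L a)) z) z
        = complex_of_real ((norm a * norm z)\<^sup>2 - (norm (blinfun_apply a z))\<^sup>2)"
      by (simp add: blinfun.diff_left cinner_diff_left scaleC_blinfun.rep_eq cinner_cadjoint_left
          bounded_clinear a cinner_self power_mult_distrib)
    ultimately show "cinner (blinfun_apply (?K *\<^sub>C id_blinfun - (cadjoint a o\<^sub>L a)) z) z \<in> \<real>\<^sub>\<ge>\<^sub>0"
      by (simp only: nonneg_Reals_of_real_iff)
  qed (intro diff scaleC id aa)
  hence "Re (cinner (blinfun_apply (\<phi> (cadjoint a o\<^sub>L a)) x) x) \<le> (norm a * norm x)\<^sup>2"
    by (simp add: complex_nonneg_Reals_iff phi_diff phi_scaleC scaleC id aa unit blinfun.diff_left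
        cinner_diff_left scaleC_blinfun.rep_eq cinner_self power_mult_distrib flip: of_real_power of_real_mult)
  moreover have "Re (cinner (blinfun_apply (\<phi> a) x) (blinfun_apply (\<phi> a) x)) = (norm (blinfun_apply (\<phi> a) x))\<^sup>2"
    by (simp add: cinner_self flip: of_real_power)
  ultimately have "(norm (blinfun_apply (\<phi> a) x))\<^sup>2 \<le> (norm a * norm x)\<^sup>2"
    using schwarz_defect_nonneg [OF a, of x "blinfun_apply (\<phi> a) x"] by linarith
  thus "norm (blinfun_apply (\<phi> a) x) \<le> norm a * norm x"
    by (rule power2_le_imp_le) simp
qed simp

text \<open>If \<open>\<phi> a = V\<^sup>* \<pi>(a) V\<close> is a Stinespring dilation, this says that \<open>\<pi>(a) V x = V y\<close>.\<close>

definition intertwines :: "('a \<Rightarrow>\<^sub>L 'a) \<Rightarrow> 'b \<Rightarrow> 'b \<Rightarrow> bool"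
  where "intertwines a x y \<longleftrightarrow>
    a \<in> B \<and> (\<forall>b\<in>B. blinfun_apply (\<phi> (b o\<^sub>L a)) x = blinfun_apply (\<phi> b) y)"

text \<open>The bound says that \<open>\<pi>(a) V x - V y\<close> has squared norm at most 0, so it
  is a null vector of the positive form and pairs to 0 with every
  \<open>\<pi>(cadjoint b) V z\<close>.\<close>

lemma intertwinesI:
  assumes a: "a \<in> B"
    and le: "Re (cinner (blinfun_apply (\<phi> (cadjoint a o\<^sub>L a)) x) x) + (norm y)\<^sup>2
      \<le> 2 * Re (cinner (blinfun_apply (\<phi> a) x) y)"
  shows "intertwines a x y"
  unfolding intertwines_def
proof (intro conjI ballI a cinner_left_eqI)
  fix b z assume b: "b \<in> B"
  define p where "p = cinner (blinfun_apply (\<phi> (b o\<^sub>L a)) x - blinfun_apply (\<phi> b) y) z"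
  define R where "R = Re (cinner (blinfun_apply (\<phi> (b o\<^sub>L cadjoint b)) z) z)"
  \<comment> \<open>Three rows \<open>a\<close>, identity and \<open>cadjoint b\<close>, tested on
    \<open>x\<close>, \<open>- y\<close> and \<open>s *\<^sub>C z\<close>. The first two make up the
    null vector; up to the scalar \<open>s\<close>, \<open>p\<close> is its pairing with the third
    and \<open>R\<close> the squared norm of the third.\<close>
  let ?c = "case_nat a (case_nat id_blinfun (\<lambda>_. cadjoint b))"
  have c: "?c i \<in> B" for i
    using a b id adjoint by (simp split: nat.split)
  have ba: "cadjoint a o\<^sub>L cadjoint b = cadjoint (b o\<^sub>L a)"
    by (simp add: cadjoint_compose bounded_clinear a b)
  have form: "0 \<le> 2 * Re (cnj s * p) + (cmod s)\<^sup>2 * R" for s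
  proof -
    have "Re (cinner (s *\<^sub>C z) (blinfun_apply (\<phi> a') x')) = Re (cinner (blinfun_apply (\<phi> a') x') (s *\<^sub>C z))" for a' x'
      by (subst cinner_commute) simp
    moreover have "Re (cinner y (blinfun_apply (\<phi> a) x)) = Re (cinner (blinfun_apply (\<phi> a) x) y)"
      by (subst cinner_commute) simp
    moreover have "Re (cinner (blinfun_apply (\<phi> (b o\<^sub>L cadjoint b)) (s *\<^sub>C z)) (s *\<^sub>C z)) = (cmod s)\<^sup>2 * R"
    proof -
      have "cnj s * s = complex_of_real ((cmod s)\<^sup>2)"
        using complex_norm_square [of s] by (simp add: mult.commute)
      thus ?thesis unfolding R_def
        by (simp add: bounded_clinear_opsD phi_bounded_clinear compose adjoint b
            mult.assoc [symmetric] flip: of_real_power)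
    qed
    moreover have "Re (cnj s * p) = Re (cinner (blinfun_apply (\<phi> (b o\<^sub>L a)) x) (s *\<^sub>C z))
        - Re (cinner (blinfun_apply (\<phi> b) y) (s *\<^sub>C z))"
      by (simp add: p_def cinner_diff_left algebra_simps)
    ultimately show ?thesis
      using form_nonneg [of 3 ?c "case_nat x (case_nat (- y) (\<lambda>_. s *\<^sub>C z))", OF c] le
      by (simp add: eval_nat_numeral complex_nonneg_Reals_iff cadjoint_id unit ba
          cinner_phi_cadjoint compose a b cadjoint_cadjoint bounded_clinear cinner_self blinfun.minus_right
          del: cinner_scaleC_right cinner_scaleC_left)
  qed
  have "p = 0"
  proof (rule ccontr)
    assume "p \<noteq> 0"
    \<comment> \<open>For \<open>s = - t p\<close> the right side of \<open>form\<close> is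
      \<open>t |p|^2 (t R - 2)\<close>, hence the choice of a positive \<open>t\<close> with
      \<open>t R < 2\<close>.\<close>
    define t where "t = 1 / (\<bar>R\<bar> + 1)"
    have "0 \<le> - (2 * t) * (cmod p)\<^sup>2 + t\<^sup>2 * (cmod p)\<^sup>2 * R"
    proof -
      have "cnj (- complex_of_real t * p) * p = complex_of_real (- t * (cmod p)\<^sup>2)"
        using complex_norm_square [of p] by (simp add: mult_ac)
      hence "Re (cnj (- complex_of_real t * p) * p) = - t * (cmod p)\<^sup>2"
        by (simp only: Re_complex_of_real)
      thus ?thesis
        using form [of "- complex_of_real t * p"] by (simp only: norm_mult power_mult_distrib) simp
    qed
    hence "0 \<le> (t * (cmod p)\<^sup>2) * (t * R - 2)" by (simp add: power2_eq_square algebra_simps)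
    moreover have t: "t > 0" "t * R < 2" by (auto simp: t_def field_simps abs_if)
    moreover have "t * (cmod p)\<^sup>2 > 0" using t(1) \<open>p \<noteq> 0\<close> by simp
    ultimately show False by (simp add: zero_le_mult_iff)
  qed
  thus "cinner (blinfun_apply (\<phi> (b o\<^sub>L a)) x) z = cinner (blinfun_apply (\<phi> b) y) z"
    by (simp add: p_def cinner_diff_left)
qed

lemma intertwinesD:
  "intertwines a x y \<Longrightarrow> b \<in> B \<Longrightarrow> blinfun_apply (\<phi> (b o\<^sub>L a)) x = blinfun_apply (\<phi> b) y"
  by (simp add: intertwines_def)

text \<open>The bound says that \<open>a\<close> has norm at most \<open>\<surd>c\<close> on the range of \<open>P\<close>, and \<open>\<phi> a\<close> attains
  it at \<open>x\<close>, so there is no room for a component of \<open>\<pi>(a) V x\<close> orthogonal to the range of \<open>V\<close>.\<close>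

lemma intertwines_norm_attained:
  assumes a: "a \<in> B" and P: "intertwines P x x"
    and bound: "\<And>z. cinner (blinfun_apply (complex_of_real c *\<^sub>C P - (cadjoint a o\<^sub>L a o\<^sub>L P)) z) z \<in> \<real>\<^sub>\<ge>\<^sub>0"
    and attained: "(norm (blinfun_apply (\<phi> a) x))\<^sup>2 = c * (norm x)\<^sup>2"
  shows "intertwines a x (blinfun_apply (\<phi> a) x)"
    and "cinner (blinfun_apply (\<phi> (complex_of_real c *\<^sub>C P - (cadjoint a o\<^sub>L a o\<^sub>L P))) x) x = 0"
proof -
  have PB: "P \<in> B" using P by (simp add: intertwines_def)
  have aa: "cadjoint a o\<^sub>L a \<in> B" by (intro compose adjoint a)
  let ?R = "complex_of_real c *\<^sub>C P - (cadjoint a o\<^sub>L a o\<^sub>L P)"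
  have Px: "blinfun_apply (\<phi> P) x = x"
    using intertwinesD [OF P id] by (simp add: unit)
  have "?R \<in> B" by (intro diff scaleC compose aa PB)
  from phi_nonneg [OF this bound]
  have R: "cinner (blinfun_apply (\<phi> ?R) x) x \<in> \<real>\<^sub>\<ge>\<^sub>0" .
  \<comment> \<open>At \<open>x\<close> the factor \<open>P\<close> may be dropped, since
    \<open>\<pi>(P) V x = V x\<close>.\<close>
  have eq: "cinner (blinfun_apply (\<phi> ?R) x) x
      = of_real (c * (norm x)\<^sup>2) - cinner (blinfun_apply (\<phi> (cadjoint a o\<^sub>L a)) x) x"
    by (simp add: phi_diff phi_scaleC scaleC compose aa PB blinfun.diff_left scaleC_blinfun.rep_eq
        cinner_diff_left Px intertwinesD [OF P] cinner_self)
  have le: "Re (cinner (blinfun_apply (\<phi> (cadjoint a o\<^sub>L a)) x) x) \<le> (norm (blinfun_apply (\<phi> a) x))\<^sup>2"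
    using R unfolding eq attained by (simp add: complex_nonneg_Reals_iff)
  thus "intertwines a x (blinfun_apply (\<phi> a) x)"
    by (intro intertwinesI a) (simp add: cinner_self flip: of_real_power)
  have "(norm (blinfun_apply (\<phi> a) x))\<^sup>2 \<le> Re (cinner (blinfun_apply (\<phi> (cadjoint a o\<^sub>L a)) x) x)"
    using schwarz_defect_nonneg [OF a, of x "blinfun_apply (\<phi> a) x"]
    by (simp add: cinner_self flip: of_real_power)
  with R show "cinner (blinfun_apply (\<phi> ?R) x) x = 0"
    unfolding eq attained by (simp add: complex_nonneg_Reals_iff complex_eq_iff)
qed

text \<open>Since \<open>cadjoint P o\<^sub>L P\<close> is \<open>P\<close> itself, both sides of
  the criterion \<open>intertwinesI\<close> become twice the squared norm of
  \<open>x\<close>.\<close>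

lemma intertwines_projectionI:
  assumes "P \<in> B" "cadjoint P o\<^sub>L P = P"
    and "cinner (blinfun_apply (\<phi> P) x) x = of_real ((norm x)\<^sup>2)"
  shows "intertwines P x x"
  by (rule intertwinesI) (use assms in \<open>simp_all flip: of_real_power\<close>)

end

section \<open>Multiplicative domain and fixed points\<close>

locale unital_cp_endomap = unital_cp_map B \<phi>
  for B :: "('a::chilbert_space \<Rightarrow>\<^sub>L 'a) set" and \<phi> :: "('a \<Rightarrow>\<^sub>L 'a) \<Rightarrow> ('a \<Rightarrow>\<^sub>L 'a)"
begin

text \<open>Taking \<open>a = id_blinfun\<close> gives \<open>\<phi> b = b\<close>, so this is the
  part of the right multiplicative domain that \<phi> fixes.\<close>

definition right_multiplier :: "('a \<Rightarrow>\<^sub>L 'a) \<Rightarrow> bool"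
  where "right_multiplier b \<longleftrightarrow> b \<in> B \<and> (\<forall>a\<in>B. \<phi> (a o\<^sub>L b) = \<phi> a o\<^sub>L b)"

lemma right_multiplier_limit:
  assumes lim: "X \<longlonglongrightarrow> b" and X: "\<And>n::nat. right_multiplier (X n)"
  shows "right_multiplier b"
  unfolding right_multiplier_def
proof (intro conjI ballI)
  have XB: "X n \<in> B" for n using X by (simp add: right_multiplier_def)
  show b: "b \<in> B" by (rule limit [OF lim XB])
  fix a assume a: "a \<in> B"
  have "(\<lambda>n. \<phi> (a o\<^sub>L X n)) \<longlonglongrightarrow> \<phi> (a o\<^sub>L b)"
  proof (rule Lim_transform_bound [THEN LIM_zero_cancel])
    show "(\<lambda>n. (a o\<^sub>L X n) - (a o\<^sub>L b)) \<longlonglongrightarrow> 0"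
      by (intro LIM_zero bounded_bilinear.tendsto [OF bounded_bilinear_blinfun_compose] tendsto_const lim)
    show "\<forall>\<^sub>F n in sequentially. norm (\<phi> (a o\<^sub>L X n) - \<phi> (a o\<^sub>L b)) \<le> norm ((a o\<^sub>L X n) - (a o\<^sub>L b))"
      using norm_phi_le [OF diff [OF compose compose]] by (simp add: phi_diff compose a b XB)
  qed
  moreover have "\<phi> (a o\<^sub>L X n) = \<phi> a o\<^sub>L X n" for n using X a by (simp add: right_multiplier_def)
  moreover have "(\<lambda>n. \<phi> a o\<^sub>L X n) \<longlonglongrightarrow> (\<phi> a o\<^sub>L b)"
    by (intro bounded_bilinear.tendsto [OF bounded_bilinear_blinfun_compose] tendsto_const lim)
  ultimately show "\<phi> (a o\<^sub>L b) = \<phi> a o\<^sub>L b"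
    by (simp add: LIMSEQ_unique)
qed

lemma right_multiplier_compose:
  assumes "right_multiplier b" "right_multiplier c" shows "right_multiplier (b o\<^sub>L c)"
proof -
  have "a o\<^sub>L (b o\<^sub>L c) = (a o\<^sub>L b) o\<^sub>L c" for a :: "'a \<Rightarrow>\<^sub>L 'a" by (rule blinfun_eqI) simp
  moreover have "\<phi> a o\<^sub>L (b o\<^sub>L c) = (\<phi> a o\<^sub>L b) o\<^sub>L c" for a by (rule blinfun_eqI) simp
  ultimately show ?thesis using assms by (simp add: right_multiplier_def compose)
qed

lemma right_multiplier_add:
  assumes "right_multiplier b" "right_multiplier c" shows "right_multiplier (b + c)"
  using assms
  by (simp add: right_multiplier_def add phi_add compose
      bounded_bilinear.add_right [OF bounded_bilinear_blinfun_compose])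

lemma right_multiplier_scaleC:
  assumes "right_multiplier b" shows "right_multiplier (c *\<^sub>C b)"
proof -
  have "S o\<^sub>L (c *\<^sub>C b) = c *\<^sub>C (S o\<^sub>L b)" if "S \<in> bounded_clinear_ops" for S :: "'a \<Rightarrow>\<^sub>L 'a"
    by (rule blinfun_eqI) (simp add: scaleC_blinfun.rep_eq bounded_clinear_opsD that)
  thus ?thesis using assms
    by (simp add: right_multiplier_def scaleC phi_scaleC compose bounded_clinear phi_bounded_clinear)
qed

text \<open>Right multipliers form a norm-closed unital algebra, closed under limits because \<phi>
  is contractive. Imposing the condition on both \<open>b\<close> and \<open>cadjoint b\<close>
  makes it self-adjoint, hence a C*-algebra containing \<open>cstar X\<close>.\<close>

lemma eq_id_if_right_multipliers:
  assumes B: "B = cstar X"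
    and mult: "\<And>w. w \<in> X \<Longrightarrow> right_multiplier w \<and> right_multiplier (cadjoint w)"
    and b: "b \<in> B"
  shows "\<phi> b = b"
proof -
  let ?A = "{b. right_multiplier b \<and> right_multiplier (cadjoint b)}"
  have AB: "c \<in> B" if "c \<in> ?A" for c using that by (simp add: right_multiplier_def)
  have idA: "right_multiplier id_blinfun" by (simp add: right_multiplier_def id)
  have zero: "right_multiplier 0" using right_multiplier_scaleC [OF idA, of 0] by simp
  have "unital_cstar_algebra ?A"
    unfolding unital_cstar_algebra_def
  proof (intro conjI ballI)
    show "?A \<subseteq> bounded_clinear_ops" using AB bounded_clinear by blast
    have "cadjoint 0 = (0 :: 'a \<Rightarrow>\<^sub>L 'a)" by (rule cadjoint_eqI) simp
    thus "csubspace ?A"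
      unfolding complex_vector.subspace_def using zero
      by (auto simp: cadjoint_add cadjoint_scaleC bounded_clinear AB
          intro!: right_multiplier_add right_multiplier_scaleC)
    show "closed ?A"
      unfolding closed_sequential_limits
    proof (intro allI impI, elim conjE)
      fix Y c assume Y: "\<forall>n. Y n \<in> ?A" and lim: "Y \<longlonglongrightarrow> c"
      have c: "right_multiplier c" by (rule right_multiplier_limit [OF lim]) (use Y in simp)
      have "Y n \<in> B" for n using Y AB by blast
      moreover have "c \<in> B" using c by (simp add: right_multiplier_def)
      ultimately have "(\<lambda>n. cadjoint (Y n)) \<longlonglongrightarrow> cadjoint c"
        by (intro tendsto_cadjoint lim bounded_clinear)
      hence "right_multiplier (cadjoint c)" by (rule right_multiplier_limit) (use Y in simp)
      with c show "c \<in> ?A" by simp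
    qed
    show "id_blinfun \<in> ?A" using idA by (simp add: cadjoint_id)
    show "S o\<^sub>L T \<in> ?A" if "S \<in> ?A" "T \<in> ?A" for S T
      using that by (simp add: cadjoint_compose bounded_clinear AB right_multiplier_compose)
    show "cadjoint T \<in> ?A" if "T \<in> ?A" for T
      using that by (simp add: cadjoint_cadjoint bounded_clinear AB)
  qed
  moreover have "X \<subseteq> ?A" using mult by blast
  ultimately have "b \<in> ?A" using b cstar_minimal B by blast
  hence "\<phi> (id_blinfun o\<^sub>L b) = \<phi> id_blinfun o\<^sub>L b" using id unfolding right_multiplier_def by blast
  thus ?thesis by (simp add: unit)
qed

end

section \<open>Diagonal operators\<close>

lemma cinner_ket_right: "cinner f (ket a) = coord f a"
proof -
  have "((\<lambda>x. coord f x * cnj (coord (ket a) x)) has_sum coord f a) UNIV"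
    by (rule has_sum_finite_neutralI [of "{a}"]) (simp_all add: ket.rep_eq)
  thus ?thesis by (simp add: cinner_ell2_def infsumI)
qed

lemma norm_ket [simp]: "norm (ket a) = 1"
proof -
  have "complex_of_real ((norm (ket a))\<^sup>2) = 1"
    by (simp add: cinner_self [symmetric] cinner_ket_right ket.rep_eq del: of_real_power)
  hence "(norm (ket a))\<^sup>2 = 1" by (simp only: of_real_eq_1_iff)
  thus ?thesis using norm_ge_zero [of "ket a"] by (simp add: power2_eq_1_iff)
qed

lemma ell2_eqI: "(\<And>x. coord f x = coord g x) \<Longrightarrow> f = g"
  by (metis coord_inject ext)

lemma blinfun_ell2_eqI: "(\<And>f x. coord (blinfun_apply S f) x = coord (blinfun_apply T f) x) \<Longrightarrow> S = T"
  by (intro blinfun_eqI ell2_eqI)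

text \<open>The coordinates of \<open>cadjoint S y\<close> are inner products of \<open>y\<close>
  with the vectors \<open>S (ket a)\<close>, so the adjoints agree coordinatewise; this takes the
  place of a density argument.\<close>

lemma blinfun_ket_eqI:
  fixes S T :: "'a ell2 \<Rightarrow>\<^sub>L 'b::chilbert_space"
  assumes "S \<in> bounded_clinear_ops" "T \<in> bounded_clinear_ops"
    and "\<And>a. blinfun_apply S (ket a) = blinfun_apply T (ket a)"
  shows "S = T"
proof -
  have "blinfun_apply (cadjoint S) y = blinfun_apply (cadjoint T) y" for y
  proof (rule ell2_eqI)
    fix a
    have "cinner (ket a) (blinfun_apply (cadjoint S) y) = cinner (ket a) (blinfun_apply (cadjoint T) y)"
      using assms by (simp flip: cinner_cadjoint)
    hence "cnj (cinner (ket a) (blinfun_apply (cadjoint S) y)) = cnj (cinner (ket a) (blinfun_apply (cadjoint T) y))"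
      by (rule arg_cong)
    thus "coord (blinfun_apply (cadjoint S) y) a = coord (blinfun_apply (cadjoint T) y) a"
      by (simp flip: cinner_commute cinner_ket_right)
  qed
  hence "cadjoint S = cadjoint T" by (rule blinfun_eqI)
  thus ?thesis using assms cadjoint_cadjoint by metis
qed

lemma coord_sum: "coord (\<Sum>i\<in>I. f i) x = (\<Sum>i\<in>I. coord (f i) x)"
  by (induction I rule: infinite_finite_induct) (simp_all add: zero_ell2.rep_eq plus_ell2.rep_eq)

lemma closed_csubspace_kets_UNIV:
  fixes M :: "'a ell2 set"
  assumes M: "csubspace M" "closed M" and kets: "\<And>a. ket a \<in> M"
  shows "M = UNIV"
proof -
  have "f \<in> M" for f
  proof (rule closed_approachable [OF M(2), THEN iffD1], intro allI impI)
    fix e :: real assume e: "e > 0"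
    have "e\<^sup>2 > 0" using e by simp
    hence "e\<^sup>2 / 2 > 0" by simp
    \<comment> \<open>\<open>F\<close> carries all but at most \<open>e\<^sup>2 / 2\<close> of the
      squared norm; the truncation to \<open>F\<close> is orthogonal to the remainder, so Pythagoras
      bounds the distance.\<close>
    from infsum_finite_approximation [OF ell2_summable [of f] this] obtain F
      where F: "finite F" and "dist (\<Sum>x\<in>F. (cmod (coord f x))\<^sup>2) ((norm f)\<^sup>2) \<le> e\<^sup>2 / 2"
      unfolding norm_ell2_power2 by auto
    hence "\<bar>(\<Sum>x\<in>F. (cmod (coord f x))\<^sup>2) - (norm f)\<^sup>2\<bar> \<le> e\<^sup>2 / 2"
      by (simp only: dist_real_def)
    hence le: "(norm f)\<^sup>2 \<le> (\<Sum>x\<in>F. (cmod (coord f x))\<^sup>2) + e\<^sup>2 / 2"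
      by linarith
    let ?g = "\<Sum>x\<in>F. coord f x *\<^sub>C ket x"
    have g: "?g \<in> M"
      by (intro complex_vector.subspace_sum complex_vector.subspace_scale M kets)
    have coord_g: "coord ?g x = (if x \<in> F then coord f x else 0)" for x
    proof -
      have "coord ?g x = (\<Sum>y\<in>F. if x = y then coord f y else 0)"
        unfolding coord_sum by (intro sum.cong) (simp_all add: scaleC_ell2.rep_eq ket.rep_eq)
      thus ?thesis by (simp add: F)
    qed
    have "cinner (f - ?g) (coord f x *\<^sub>C ket x) = 0" if "x \<in> F" for x
      using that by (simp add: cinner_ket_right minus_ell2.rep_eq coord_g)
    hence "cinner (f - ?g) ?g = 0" unfolding cinner_sum_right by (intro sum.neutral ballI)
    with norm_add_power2 [of "f - ?g" ?g]
    have "(norm (f - ?g))\<^sup>2 = (norm f)\<^sup>2 - (norm ?g)\<^sup>2" by simp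
    moreover have "(\<Sum>x\<in>F. (cmod (coord f x))\<^sup>2) \<le> (norm ?g)\<^sup>2"
      using sum_coord_le_norm [OF F, of ?g] by (simp add: coord_g)
    ultimately have "(norm (f - ?g))\<^sup>2 < e\<^sup>2" using le \<open>e\<^sup>2 > 0\<close> by linarith
    hence "norm (f - ?g) < e" using e by (simp add: power2_less_imp_less)
    thus "\<exists>g\<in>M. dist g f < e"
      using g by (intro bexI [of _ ?g]) (simp_all add: dist_norm norm_minus_commute)
  qed
  thus ?thesis by blast
qed

section \<open>Diagonal operators with real entries\<close>

lemma bounded_range_const [simp]: "bounded (range (\<lambda>_. c))"
  by (simp add: image_constant_conv)

lemma bounded_range_indicator [simp]: "bounded (range (indicator G :: 'a \<Rightarrow> real))"
  unfolding bounded_iff by (intro exI [of _ 1]) (auto simp: indicator_def)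

lemma bounded_range_diff:
  fixes f g :: "'a \<Rightarrow> real"
  assumes "bounded (range f)" "bounded (range g)" shows "bounded (range (\<lambda>x. f x - g x))"
  by (rule bounded_minus_comp [OF assms])

lemma bounded_range_mult:
  fixes f g :: "'a \<Rightarrow> real"
  assumes "bounded (range f)" "bounded (range g)" shows "bounded (range (\<lambda>x. f x * g x))"
proof -
  obtain K L where K: "\<And>x. \<bar>f x\<bar> \<le> K" and L: "\<And>x. \<bar>g x\<bar> \<le> L"
    using assms by (auto simp: bounded_iff)
  have "\<bar>f x * g x\<bar> \<le> K * L" for x
    unfolding abs_mult using K [of x] L [of x] by (intro mult_mono) auto
  thus ?thesis by (auto simp: bounded_iff)
qed

lemma bounded_range_sum:
  fixes f :: "'i \<Rightarrow> 'a \<Rightarrow> real"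
  assumes "\<And>i. bounded (range (f i))" shows "bounded (range (\<lambda>x. \<Sum>i\<in>I. f i x))"
  by (induction I rule: infinite_finite_induct) (simp_all add: bounded_plus_comp assms)

lemma bounded_range_power:
  fixes f :: "'a \<Rightarrow> real"
  assumes "bounded (range f)" shows "bounded (range (\<lambda>x. f x ^ n))"
  by (induction n) (simp_all add: bounded_range_mult assms)

lemma bounded_rangeI: "(\<And>x. 0 \<le> f x \<and> f x \<le> K) \<Longrightarrow> bounded (range (f :: 'a \<Rightarrow> real))"
  unfolding bounded_iff by (intro exI [of _ K]) auto

lemmas bounded_range_intros = bounded_range_const bounded_range_indicator bounded_range_diff
  bounded_range_mult bounded_range_sum bounded_range_power

text \<open>Real entries make the operator self-adjoint. \<open>diag_op\<close> is unspecified for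
  unbounded entries, whence the boundedness conditions in the rules below.\<close>

definition real_diag :: "('a \<Rightarrow> real) \<Rightarrow> 'a ell2 \<Rightarrow>\<^sub>L 'a ell2"
  where "real_diag f = diag_op (\<lambda>x. complex_of_real (f x))"

abbreviation ket_proj :: "'a set \<Rightarrow> 'a ell2 \<Rightarrow>\<^sub>L 'a ell2"
  where "ket_proj G \<equiv> real_diag (indicator G)"

lemma coord_real_diag:
  assumes "bounded (range f)"
  shows "coord (blinfun_apply (real_diag f) z) x = complex_of_real (f x) * coord z x"
  unfolding real_diag_def
proof (rule coord_diag_op)
  show "bounded (range (\<lambda>x. complex_of_real (f x)))" using assms by (simp add: bounded_iff)
qed

lemma coord_ket_proj: "coord (blinfun_apply (ket_proj G) z) x = (if x \<in> G then coord z x else 0)"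
  by (simp add: coord_real_diag)

lemma real_diag_ket:
  assumes "bounded (range f)"
  shows "blinfun_apply (real_diag f) (ket x) = complex_of_real (f x) *\<^sub>C ket x"
  by (rule ell2_eqI) (simp add: coord_real_diag assms scaleC_ell2.rep_eq ket.rep_eq)

lemma real_diag_bounded_clinear:
  assumes "bounded (range f)" shows "real_diag f \<in> bounded_clinear_ops"
  unfolding bounded_clinear_ops_def
  by (auto intro!: ell2_eqI simp: coord_real_diag assms scaleC_ell2.rep_eq)

lemma real_diag_compose:
  assumes "bounded (range f)" "bounded (range g)"
  shows "real_diag f o\<^sub>L real_diag g = real_diag (\<lambda>x. f x * g x)"
  by (rule blinfun_ell2_eqI) (simp only: coord_real_diag assms bounded_range_mult blinfun_apply_blinfun_compose of_real_mult mult.assoc)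

lemma real_diag_diff:
  assumes "bounded (range f)" "bounded (range g)"
  shows "real_diag f - real_diag g = real_diag (\<lambda>x. f x - g x)"
  by (rule blinfun_ell2_eqI)
     (simp only: coord_real_diag assms bounded_range_diff blinfun.diff_left minus_ell2.rep_eq of_real_diff left_diff_distrib)

lemma real_diag_scale:
  assumes "bounded (range f)"
  shows "complex_of_real c *\<^sub>C real_diag f = real_diag (\<lambda>x. c * f x)"
  by (rule blinfun_ell2_eqI)
     (simp only: coord_real_diag assms bounded_range_mult bounded_range_const scaleC_blinfun.rep_eq scaleC_ell2.rep_eq of_real_mult mult.assoc)

lemma real_diag_sum:
  assumes "\<And>i. bounded (range (f i))"
  shows "(\<Sum>i\<in>I. real_diag (f i)) = real_diag (\<lambda>x. \<Sum>i\<in>I. f i x)"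
  by (rule blinfun_ell2_eqI)
     (simp only: coord_real_diag assms bounded_range_sum blinfun.sum_left coord_sum of_real_sum sum_distrib_right)

lemma real_diag_one: "real_diag (\<lambda>_. 1) = id_blinfun"
  by (rule blinfun_ell2_eqI) (simp only: coord_real_diag bounded_range_const blinfun_apply_id_blinfun of_real_1 mult_1)

lemma cadjoint_real_diag:
  assumes "bounded (range f)" shows "cadjoint (real_diag f) = real_diag f"
  by (rule cadjoint_eqI) (simp add: cinner_ell2_def coord_real_diag assms mult_ac)

text \<open>\<open>real_diag f\<close> is the square of the self-adjoint operator with entries
  \<open>sqrt (f x)\<close>.\<close>

lemma cinner_real_diag_nonneg:
  assumes "bounded (range f)" "\<And>x. f x \<ge> 0"
  shows "cinner (blinfun_apply (real_diag f) z) z \<in> \<real>\<^sub>\<ge>\<^sub>0"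
proof -
  obtain K where K: "\<And>x. \<bar>f x\<bar> \<le> K" using assms by (auto simp: bounded_iff)
  have r: "bounded (range (\<lambda>x. sqrt (f x)))"
    by (rule bounded_rangeI [of _ "sqrt K"]) (use K assms(2) in \<open>auto simp: abs_le_iff\<close>)
  have "real_diag f = real_diag (\<lambda>x. sqrt (f x)) o\<^sub>L real_diag (\<lambda>x. sqrt (f x))"
    using assms(2) by (simp add: real_diag_compose r)
  hence "cinner (blinfun_apply (real_diag f) z) z
      = cinner (blinfun_apply (real_diag (\<lambda>x. sqrt (f x))) z) (blinfun_apply (real_diag (\<lambda>x. sqrt (f x))) z)"
    using cinner_cadjoint [OF real_diag_bounded_clinear [OF r]] by (simp only: cadjoint_real_diag r blinfun_apply_blinfun_compose)
  thus ?thesis by (simp only: cinner_self_nonneg)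
qed

lemma norm_real_diag_le:
  assumes K: "\<And>x. \<bar>f x\<bar> \<le> K" shows "norm (real_diag f) \<le> K"
proof (rule norm_blinfun_bound)
  have f: "bounded (range f)" using K by (auto simp: bounded_iff)
  show K0: "0 \<le> K" using K [of undefined] by linarith
  fix z
  have "cinner (blinfun_apply (real_diag (\<lambda>x. K\<^sup>2 * 1 - f x * f x)) z) z \<in> \<real>\<^sub>\<ge>\<^sub>0"
  proof (rule cinner_real_diag_nonneg)
    show "bounded (range (\<lambda>x. K\<^sup>2 * 1 - f x * f x))" by (intro bounded_range_intros f)
    show "0 \<le> K\<^sup>2 * 1 - f x * f x" for x
      using power_mono [OF K [of x], of 2] by (simp add: power2_eq_square)
  qed
  also have "real_diag (\<lambda>x. K\<^sup>2 * 1 - f x * f x) = complex_of_real (K\<^sup>2) *\<^sub>C id_blinfun - (cadjoint (real_diag f) o\<^sub>L real_diag f)"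
    by (simp only: real_diag_diff [symmetric] real_diag_scale [symmetric] real_diag_one real_diag_compose
        cadjoint_real_diag bounded_range_intros f)
  finally have "(norm (blinfun_apply (real_diag f) z))\<^sup>2 \<le> (K * norm z)\<^sup>2"
    using cinner_cadjoint_left [OF real_diag_bounded_clinear [OF f]]
    by (simp add: blinfun.diff_left cinner_diff_left scaleC_blinfun.rep_eq cinner_self complex_nonneg_Reals_iff
        power_mult_distrib flip: of_real_power of_real_mult)
  thus "norm (blinfun_apply (real_diag f) z) \<le> K * norm z"
    by (rule power2_le_imp_le) (simp add: K0)
qed

text \<open>The powers of \<open>f / c\<close> converge uniformly to the indicator function of \<open>{f = c}\<close>.\<close>

lemma ket_proj_level_set:
  fixes f :: "'a \<Rightarrow> real"
  assumes B: "unital_cstar_algebra B" and f: "real_diag f \<in> B" "\<And>x. 0 \<le> f x"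
    and gap: "0 \<le> d" "d < c" "\<And>x. f x = c \<or> f x \<le> d"
  shows "ket_proj {x. f x = c} \<in> B"
proof -
  have scaleC: "s *\<^sub>C T \<in> B" and compose: "S \<in> B \<Longrightarrow> T \<in> B \<Longrightarrow> S o\<^sub>L T \<in> B" if "T \<in> B" for s S T
    using B that complex_vector.subspace_scale [of B T s] by (auto simp: unital_cstar_algebra_def)
  let ?h = "\<lambda>x. 1 / c * f x"
  have bf: "bounded (range f)" by (rule bounded_rangeI [of _ c]) (metis f(2) gap less_imp_le order_trans order_refl)
  have h: "bounded (range ?h)" by (intro bounded_range_intros bf)
  have powers: "real_diag (\<lambda>x. ?h x ^ n) \<in> B" for n
  proof (induction n)
    case 0
    thus ?case using B by (simp add: real_diag_one unital_cstar_algebra_def)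
  next
    case (Suc n)
    have "real_diag (\<lambda>x. ?h x ^ Suc n) = complex_of_real (1 / c) *\<^sub>C real_diag f o\<^sub>L real_diag (\<lambda>x. ?h x ^ n)"
      by (simp only: power_Suc real_diag_scale real_diag_compose bf h bounded_range_power)
    thus ?case using Suc f(1) by (simp only: compose scaleC)
  qed
  have lim: "(\<lambda>n. real_diag (\<lambda>x. ?h x ^ n)) \<longlonglongrightarrow> ket_proj {x. f x = c}"
  proof (rule Lim_transform_bound [THEN LIM_zero_cancel])
    \<comment> \<open>Off the level set \<open>f x / c\<close> is at most \<open>d / c < 1\<close>,
      so the convergence is uniform at this rate.\<close>
    show "(\<lambda>n. (d / c) ^ n) \<longlonglongrightarrow> 0" using gap by (intro LIMSEQ_power_zero) simp
    have "norm (real_diag (\<lambda>x. ?h x ^ n) - ket_proj {x. f x = c}) \<le> (d / c) ^ n" for n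
      unfolding real_diag_diff [OF bounded_range_power [OF h] bounded_range_indicator]
    proof (rule norm_real_diag_le)
      fix x
      show "\<bar>(1 / c * f x) ^ n - indicator {x. f x = c} x\<bar> \<le> (d / c) ^ n"
      proof (cases "f x = c")
        case True
        thus ?thesis using gap by simp
      next
        case False
        hence "f x \<le> d" using gap(3) by blast
        hence "(f x / c) ^ n \<le> (d / c) ^ n"
          using gap f(2) [of x] by (intro power_mono divide_right_mono) auto
        thus ?thesis using False gap f(2) [of x] by simp
      qed
    qed
    thus "\<forall>\<^sub>F n in sequentially. norm (real_diag (\<lambda>x. ?h x ^ n) - ket_proj {x. f x = c}) \<le> norm ((d / c) ^ n)"
      using gap by simp
  qed
  show ?thesis
    by (rule closed_sequentially [OF _ powers lim]) (use B in \<open>simp add: unital_cstar_algebra_def\<close>)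
qed

text \<open>With finitely many values above \<open>m\<close> the supremum is attained:
  \<open>c\<close> is the maximum, and \<open>d\<close> the largest remaining value above
  \<open>m\<close>, or \<open>m\<close> itself if there is none.\<close>

lemma finite_superlevel_gap:
  fixes f :: "'a \<Rightarrow> real"
  assumes fin: "finite {x. f x > m}" and y: "f y > m"
  obtains c d where "m \<le> d" "d < c" "\<And>x. f x = c \<or> f x \<le> d" "finite {x. f x = c}" "\<exists>x. f x = c"
proof -
  define c where "c = Max (f ` {x. f x > m})"
  define d where "d = Max (insert m (f ` ({x. f x > m} - {x. f x = c})))"
  have c: "c \<in> f ` {x. f x > m}" unfolding c_def using fin y by (intro Max_in) auto
  have le: "f x \<le> c" if "f x > m" for x unfolding c_def using fin that by (intro Max_ge) auto
  have fin': "finite (insert m (f ` ({x. f x > m} - {x. f x = c})))" using fin by simp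
  have "d < c" unfolding d_def using fin' c le by (subst Max_less_iff) (auto simp: less_le)
  moreover have d: "m \<le> d" unfolding d_def by (rule Max_ge [OF fin']) simp
  moreover have "f x = c \<or> f x \<le> d" for x
  proof (cases "f x > m")
    case True
    thus ?thesis unfolding d_def using Max_ge [OF fin', of "f x"] by auto
  qed (use d in linarith)
  moreover have "finite {x. f x = c}" by (rule finite_subset [OF _ fin]) (use c in auto)
  ultimately show thesis using that c by blast
qed

section \<open>Sets of basis vectors fixed by a completely positive map\<close>

locale unital_cp_ell2 = unital_cp_endomap B \<phi>
  for B :: "('c ell2 \<Rightarrow>\<^sub>L 'c ell2) set" and \<phi> :: "('c ell2 \<Rightarrow>\<^sub>L 'c ell2) \<Rightarrow> ('c ell2 \<Rightarrow>\<^sub>L 'c ell2)"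
begin

text \<open>In terms of a Stinespring dilation, \<open>V e\<^sub>\<gamma>\<close> lies in the range of \<open>\<pi>(P\<^sub>G)\<close> for all \<open>\<gamma> \<in> G\<close>.\<close>

definition localized :: "'c set \<Rightarrow> bool"
  where "localized G \<longleftrightarrow> finite G \<and> ket_proj G \<in> B \<and> (\<forall>\<gamma>\<in>G. intertwines (ket_proj G) (ket \<gamma>) (ket \<gamma>))"

lemma localizedD:
  assumes "localized G"
  shows "finite G" "ket_proj G \<in> B" "\<gamma> \<in> G \<Longrightarrow> intertwines (ket_proj G) (ket \<gamma>) (ket \<gamma>)"
  using assms by (simp_all add: localized_def)

text \<open>Positivity squeezes the expectation of \<open>\<phi> (ket_proj G - ket_proj G')\<close>
  at \<open>e\<close> between 0 and that of \<open>\<phi> (real_diag r)\<close> divided by \<delta>,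
  which is at most 0. So \<open>ket_proj G'\<close> keeps the full norm of \<open>e\<close>.\<close>

lemma intertwines_ket_proj_squeeze:
  assumes G: "ket_proj G \<in> B" "ket_proj G' \<in> B" "G' \<subseteq> G"
    and e: "blinfun_apply (\<phi> (ket_proj G)) e = e"
    and r: "bounded (range r)" "real_diag r \<in> B" "Re (cinner (blinfun_apply (\<phi> (real_diag r)) e) e) \<le> 0"
    and \<delta>: "\<delta> > 0" "\<And>x. \<delta> * (indicator G x - indicator G' x) \<le> r x"
  shows "intertwines (ket_proj G') e e"
proof (rule intertwines_projectionI)
  let ?P = "ket_proj G" and ?P' = "ket_proj G'"
  show "cadjoint ?P' o\<^sub>L ?P' = ?P'"
    by (simp add: cadjoint_real_diag real_diag_compose flip: indicator_inter_arith)
  have D: "?P - ?P' \<in> B" by (intro diff G)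
  have diag: "?P - ?P' = real_diag (\<lambda>x. indicator G x - indicator G' x)"
    by (rule real_diag_diff) simp_all
  have bd: "bounded (range (\<lambda>x. indicator G x - indicator G' x :: real))"
    by (intro bounded_range_intros)
  have "cinner (blinfun_apply (\<phi> (?P - ?P')) e) e \<in> \<real>\<^sub>\<ge>\<^sub>0"
    by (rule phi_nonneg [OF D], unfold diag, rule cinner_real_diag_nonneg [OF bd])
       (use G(3) in \<open>auto simp: indicator_def\<close>)
  moreover have "Re (cinner (blinfun_apply (\<phi> (?P - ?P')) e) e) \<le> 0"
  proof -
    let ?S = "real_diag r - complex_of_real \<delta> *\<^sub>C (?P - ?P')"
    have S: "?S = real_diag (\<lambda>x. r x - \<delta> * (indicator G x - indicator G' x))"
      unfolding diag by (simp only: real_diag_scale real_diag_diff bounded_range_intros r(1))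
    have "cinner (blinfun_apply (\<phi> ?S) e) e \<in> \<real>\<^sub>\<ge>\<^sub>0"
    proof (rule phi_nonneg)
      show "?S \<in> B" by (intro diff scaleC D r(2) G)
      show "cinner (blinfun_apply ?S x) x \<in> \<real>\<^sub>\<ge>\<^sub>0" for x
        unfolding S by (rule cinner_real_diag_nonneg) (intro bounded_range_intros r(1), use \<delta> in simp)
    qed
    hence "\<delta> * Re (cinner (blinfun_apply (\<phi> (?P - ?P')) e) e) \<le> Re (cinner (blinfun_apply (\<phi> (real_diag r)) e) e)"
      by (simp add: phi_diff [OF r(2) scaleC [OF D]] phi_scaleC [OF D] blinfun.diff_left cinner_diff_left
          scaleC_blinfun.rep_eq complex_nonneg_Reals_iff)
    with r(3) have "\<delta> * Re (cinner (blinfun_apply (\<phi> (?P - ?P')) e) e) \<le> 0" by linarith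
    thus ?thesis using \<delta>(1) by (simp add: mult_le_0_iff)
  qed
  ultimately have "cinner (blinfun_apply (\<phi> (?P - ?P')) e) e = 0"
    by (simp add: complex_nonneg_Reals_iff complex_eq_iff)
  thus "cinner (blinfun_apply (\<phi> ?P') e) e = of_real ((norm e)\<^sup>2)"
    by (simp add: phi_diff G e blinfun.diff_left cinner_diff_left cinner_self)
qed (rule G)

text \<open>The product of \<open>a\<close> and \<open>ket_proj G\<close> has squared norm
  \<open>f \<gamma>\<close>, and \<open>\<phi> a = a\<close> attains it at
  \<open>ket \<gamma>\<close>. The second conclusion is the vanishing expectation that feeds
  \<open>intertwines_ket_proj_squeeze\<close>.\<close>

lemma localized_norm_attained:
  assumes a: "a \<in> B" "\<phi> a = a" "cadjoint a o\<^sub>L a = real_diag f"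
    and f: "bounded (range f)"
    and G: "localized G" "\<gamma> \<in> G" "\<And>x. x \<in> G \<Longrightarrow> f x \<le> f \<gamma>"
  shows "intertwines a (ket \<gamma>) (blinfun_apply a (ket \<gamma>))"
    and "cinner (blinfun_apply (\<phi> (real_diag (\<lambda>x. f \<gamma> * indicator G x - f x * indicator G x))) (ket \<gamma>)) (ket \<gamma>) = 0"
proof -
  have bd: "bounded (range (\<lambda>x. f \<gamma> * indicator G x - f x * indicator G x))"
    by (intro bounded_range_intros f)
  have R: "complex_of_real (f \<gamma>) *\<^sub>C ket_proj G - (cadjoint a o\<^sub>L a o\<^sub>L ket_proj G)
      = real_diag (\<lambda>x. f \<gamma> * indicator G x - f x * indicator G x)"
    by (simp only: a(3) real_diag_scale real_diag_compose real_diag_diff bounded_range_intros f)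
  have bound: "cinner (blinfun_apply (complex_of_real (f \<gamma>) *\<^sub>C ket_proj G - (cadjoint a o\<^sub>L a o\<^sub>L ket_proj G)) z) z \<in> \<real>\<^sub>\<ge>\<^sub>0" for z
    unfolding R by (rule cinner_real_diag_nonneg [OF bd]) (use G(3) in \<open>auto simp: indicator_def\<close>)
  have "complex_of_real ((norm (blinfun_apply a (ket \<gamma>)))\<^sup>2) = cinner (blinfun_apply (cadjoint a o\<^sub>L a) (ket \<gamma>)) (ket \<gamma>)"
    by (simp add: cinner_cadjoint_left bounded_clinear a(1) cinner_self)
  also have "\<dots> = complex_of_real (f \<gamma>)"
    unfolding a(3) by (simp add: real_diag_ket f cinner_self)
  finally have "(norm (blinfun_apply a (ket \<gamma>)))\<^sup>2 = f \<gamma> * (norm (ket \<gamma>))\<^sup>2"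
    by (simp only: of_real_eq_iff) simp
  from intertwines_norm_attained [OF a(1) localizedD(3) [OF G(1,2)] bound, unfolded a(2), OF this]
  show "intertwines a (ket \<gamma>) (blinfun_apply a (ket \<gamma>))"
    and "cinner (blinfun_apply (\<phi> (real_diag (\<lambda>x. f \<gamma> * indicator G x - f x * indicator G x))) (ket \<gamma>)) (ket \<gamma>) = 0"
    unfolding R .
qed

text \<open>\<open>G'\<close> is the set where \<open>f\<close> is maximal on \<open>G\<close>. The
  gap below the maximum puts its projection into the algebra and serves as the \<delta> of the
  squeeze.\<close>

lemma localized_maximizers:
  assumes a: "a \<in> B" "\<phi> a = a" "cadjoint a o\<^sub>L a = real_diag f"
    and f: "bounded (range f)" "\<And>x. 0 \<le> f x"
    and G: "localized G" "\<gamma> \<in> G" "f \<gamma> > 0"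
  obtains G' c where "G' \<subseteq> G" "G' \<noteq> {}" "c > 0" "localized G'" "\<And>x. x \<in> G' \<Longrightarrow> f x = c"
    "\<And>x. x \<in> G' \<Longrightarrow> intertwines a (ket x) (blinfun_apply a (ket x))"
proof -
  \<comment> \<open>The symbol of \<open>cadjoint a o\<^sub>L a o\<^sub>L ket_proj G\<close>; the
    cut-off makes it positive at finitely many indices only.\<close>
  let ?h = "\<lambda>x. f x * indicator G x"
  have fin: "finite {x. ?h x > 0}"
    by (rule finite_subset [OF _ localizedD(1) [OF G(1)]]) (auto simp: indicator_def split: if_splits)
  have pos: "?h \<gamma> > 0" using G by simp
  obtain c d where cd: "0 \<le> d" "d < c" "\<And>x. ?h x = c \<or> ?h x \<le> d"
      "finite {x. ?h x = c}" "\<exists>x. ?h x = c"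
    by (rule finite_superlevel_gap [OF fin pos], rule that)
  define G' where "G' = {x. ?h x = c}"
  have sub: "G' \<subseteq> G" using cd by (auto simp: G'_def indicator_def split: if_splits)
  have fc: "f x = c" if "x \<in> G'" for x
    using that sub by (auto simp: G'_def)
  have le: "f x \<le> c" if "x \<in> G" for x using cd(2) cd(3) [of x] that by auto
  have aa: "cadjoint a o\<^sub>L a \<in> B" by (intro compose adjoint a)
  have h: "real_diag ?h \<in> B"
    using compose [OF aa localizedD(2) [OF G(1)]] f(1) unfolding a(3)
    by (simp add: real_diag_compose)
  have P: "ket_proj G' \<in> B"
    unfolding G'_def by (rule ket_proj_level_set [OF cstar h _ cd(1-3)]) (simp add: f)
  have att: "intertwines a (ket x) (blinfun_apply a (ket x))"
    "cinner (blinfun_apply (\<phi> (real_diag (\<lambda>y. c * indicator G y - f y * indicator G y))) (ket x)) (ket x) = 0"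
    if "x \<in> G'" for x
    using localized_norm_attained [OF a f(1) G(1), of x] that sub fc le by auto
  have "intertwines (ket_proj G') (ket x) (ket x)" if x: "x \<in> G'" for x
  proof (rule intertwines_ket_proj_squeeze [OF localizedD(2) [OF G(1)] P sub])
    have "x \<in> G" using sub x by blast
    show "blinfun_apply (\<phi> (ket_proj G)) (ket x) = ket x"
      using intertwinesD [OF localizedD(3) [OF G(1) \<open>x \<in> G\<close>] id] by (simp add: unit)
    let ?r = "\<lambda>y. c * indicator G y - f y * indicator G y"
    show "bounded (range ?r)" by (intro bounded_range_intros f)
    have "real_diag ?r = complex_of_real c *\<^sub>C ket_proj G - real_diag ?h"
      by (simp only: real_diag_scale real_diag_diff bounded_range_intros f)
    thus "real_diag ?r \<in> B" by (simp only: diff scaleC h localizedD(2) [OF G(1)])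
    show "Re (cinner (blinfun_apply (\<phi> (real_diag ?r)) (ket x)) (ket x)) \<le> 0"
      using att(2) [OF x] by simp
    show "c - d > 0" using cd by simp
    show "(c - d) * (indicator G y - indicator G' y) \<le> ?r y" for y
      using cd(1) cd(3) [of y] fc [of y] sub by (auto simp: indicator_def G'_def)
  qed
  hence "localized G'" using cd(4) P by (simp add: localized_def G'_def)
  moreover have "G' \<noteq> {}" using cd(5) by (auto simp: G'_def)
  moreover have "c > 0" using cd by linarith
  ultimately show thesis using that sub fc att(1) by blast
qed

text \<open>In the dilation, \<open>\<pi>(P') V y = \<pi>(P') \<pi>(a) V x = \<pi>(a) \<pi>(P) V x =
  \<pi>(a) V x = V y\<close>.\<close>

lemma intertwines_transport:
  assumes a: "intertwines a x y" and P: "intertwines P x x"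
    and P': "P' \<in> B" "P' o\<^sub>L a = a o\<^sub>L P"
  shows "intertwines P' y y"
  unfolding intertwines_def
proof (intro conjI ballI P'(1))
  fix c assume c: "c \<in> B"
  have aB: "a \<in> B" using a by (simp add: intertwines_def)
  have assoc: "c o\<^sub>L S o\<^sub>L T = c o\<^sub>L (S o\<^sub>L T)" for S T by (rule blinfun_eqI) simp
  have "blinfun_apply (\<phi> (c o\<^sub>L P')) y = blinfun_apply (\<phi> (c o\<^sub>L P' o\<^sub>L a)) x"
    by (rule intertwinesD [OF a, symmetric]) (intro compose c P')
  also have "c o\<^sub>L P' o\<^sub>L a = c o\<^sub>L a o\<^sub>L P" unfolding assoc P'(2) ..
  also have "blinfun_apply (\<phi> (c o\<^sub>L a o\<^sub>L P)) x = blinfun_apply (\<phi> (c o\<^sub>L a)) x"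
    by (rule intertwinesD [OF P]) (intro compose c aB)
  also have "\<dots> = blinfun_apply (\<phi> c) y" by (rule intertwinesD [OF a c])
  finally show "blinfun_apply (\<phi> (c o\<^sub>L P')) y = blinfun_apply (\<phi> c) y" .
qed

lemma intertwines_scaleC_cancel:
  assumes "intertwines P (s *\<^sub>C x) (s *\<^sub>C x)" "s \<noteq> 0"
  shows "intertwines P x x"
proof -
  have P: "P \<in> B" using assms by (simp add: intertwines_def)
  have "blinfun_apply (\<phi> (c o\<^sub>L P)) x = blinfun_apply (\<phi> c) x" if c: "c \<in> B" for c
  proof -
    have "s *\<^sub>C blinfun_apply (\<phi> (c o\<^sub>L P)) x = s *\<^sub>C blinfun_apply (\<phi> c) x"
      using intertwinesD [OF assms(1) c]
      by (simp add: bounded_clinear_opsD phi_bounded_clinear compose c P)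
    thus ?thesis using assms(2) by (simp add: complex_vector.scale_left_imp_eq)
  qed
  thus ?thesis using P by (simp add: intertwines_def)
qed

lemma right_multiplier_if_intertwines_kets:
  assumes a: "a \<in> B" and int: "\<And>x. intertwines a (ket x) (blinfun_apply a (ket x))"
  shows "right_multiplier a"
  unfolding right_multiplier_def
proof (intro conjI ballI a blinfun_ket_eqI)
  fix c assume c: "c \<in> B"
  show "\<phi> (c o\<^sub>L a) \<in> bounded_clinear_ops" by (intro phi_bounded_clinear compose c a)
  show "\<phi> c o\<^sub>L a \<in> bounded_clinear_ops"
    using phi_bounded_clinear [OF c] bounded_clinear [OF a] by (simp add: bounded_clinear_ops_def)
  show "blinfun_apply (\<phi> (c o\<^sub>L a)) (ket x) = blinfun_apply (\<phi> c o\<^sub>L a) (ket x)" for x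
    using intertwinesD [OF int c] by simp
qed

end

section \<open>Weighted left creation operators\<close>

locale weighted_fock =
  fixes b :: "'n::finite list \<Rightarrow> real"
  assumes pos: "\<And>\<alpha>. b \<alpha> > 0" and bdd: "\<And>i. bdd_above (range (\<lambda>\<alpha>. b \<alpha> / b (i # \<alpha>)))"
begin

abbreviation W :: "'n \<Rightarrow> 'n fock \<Rightarrow>\<^sub>L 'n fock"
  where "W \<equiv> weighted_left_creation b"

text \<open>The square of the factor that \<open>W i\<close> puts on \<open>ket \<alpha>\<close>,
  hence the eigenvalue of \<open>cadjoint (W i) o\<^sub>L W i\<close> there.\<close>

definition weight :: "'n \<Rightarrow> 'n list \<Rightarrow> real"
  where "weight i \<alpha> = b \<alpha> / b (i # \<alpha>)"

text \<open>The eigenvalue of \<open>W i o\<^sub>L cadjoint (W i)\<close> at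
  \<open>ket \<gamma>\<close>; it is positive exactly on the words that begin with
  \<open>i\<close>.\<close>

definition co_weight :: "'n \<Rightarrow> 'n list \<Rightarrow> real"
  where "co_weight i \<gamma> = (case \<gamma> of [] \<Rightarrow> 0 | j # \<alpha> \<Rightarrow> if j = i then weight i \<alpha> else 0)"

lemma weight_pos: "weight i \<alpha> > 0"
  by (simp add: weight_def pos)

lemma bounded_weight: "bounded (range (weight i))"
proof -
  obtain K where "\<And>\<alpha>. weight i \<alpha> \<le> K"
    using bdd [of i] by (auto simp: bdd_above_def weight_def)
  thus ?thesis using weight_pos by (intro bounded_rangeI [of _ K]) (simp add: less_imp_le)
qed

lemma co_weight_nonneg: "co_weight i \<gamma> \<ge> 0"
  using weight_pos by (simp add: co_weight_def less_imp_le split: list.split)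

lemma bounded_co_weight: "bounded (range (co_weight i))"
proof -
  obtain K where K: "\<And>\<alpha>. \<bar>weight i \<alpha>\<bar> \<le> K"
    using bounded_weight [of i] by (auto simp: bounded_iff)
  have "K \<ge> 0" using K [of "[]"] by linarith
  have "co_weight i \<gamma> \<le> K" for \<gamma>
    using K \<open>K \<ge> 0\<close> by (auto simp: co_weight_def abs_le_iff split: list.split)
  thus ?thesis using co_weight_nonneg by (intro bounded_rangeI [of _ K]) simp
qed

lemma coord_W:
  "coord (blinfun_apply (W i) z) \<gamma>
    = (case \<gamma> of [] \<Rightarrow> 0 | j # \<alpha> \<Rightarrow> if j = i then complex_of_real (sqrt (weight i \<alpha>)) * coord z \<alpha> else 0)"
proof -
  obtain K where K: "\<And>\<alpha>. \<bar>weight i \<alpha>\<bar> \<le> K"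
    using bounded_weight [of i] by (auto simp: bounded_iff)
  have "bounded (range (\<lambda>\<alpha>. sqrt (weight i \<alpha>)))"
    by (rule bounded_rangeI [of _ "sqrt K"]) (use K weight_pos in \<open>auto simp: abs_le_iff less_imp_le\<close>)
  from coord_real_diag [OF this] show ?thesis
    by (simp add: weighted_left_creation_def left_creation.rep_eq left_creation_fun.rep_eq
        real_diag_def weight_def split: list.split)
qed

lemma W_bounded_clinear: "W i \<in> bounded_clinear_ops"
  unfolding bounded_clinear_ops_def
  by (auto intro!: ell2_eqI simp: coord_W scaleC_ell2.rep_eq split: list.split)

lemma W_ket: "blinfun_apply (W i) (ket \<alpha>) = complex_of_real (sqrt (weight i \<alpha>)) *\<^sub>C ket (i # \<alpha>)"
  using weighted_left_creation_ket [of b i \<alpha>] pos bdd by (simp add: weight_def)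

lemma coord_cadjoint_W:
  "coord (blinfun_apply (cadjoint (W i)) z) \<alpha> = complex_of_real (sqrt (weight i \<alpha>)) * coord z (i # \<alpha>)"
proof -
  have "cinner (blinfun_apply (cadjoint (W i)) z) (ket \<alpha>) = cinner z (blinfun_apply (W i) (ket \<alpha>))"
    by (rule cinner_cadjoint_left [OF W_bounded_clinear])
  thus ?thesis by (simp add: cinner_ket_right W_ket)
qed

lemma cadjoint_W_ket:
  "blinfun_apply (cadjoint (W i)) (ket (i # \<alpha>)) = complex_of_real (sqrt (weight i \<alpha>)) *\<^sub>C ket \<alpha>"
  by (rule ell2_eqI) (simp add: coord_cadjoint_W scaleC_ell2.rep_eq ket.rep_eq)

lemma of_real_sqrt_weight_power2: "complex_of_real (sqrt (weight i \<alpha>)) * complex_of_real (sqrt (weight i \<alpha>)) = of_real (weight i \<alpha>)"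
  using weight_pos [of i \<alpha>] by (simp flip: of_real_mult)

lemma sqrt_weight_neq_0: "complex_of_real (sqrt (weight i \<alpha>)) \<noteq> 0"
  using weight_pos [of i \<alpha>] by simp

lemma cadjoint_W_compose_W: "cadjoint (W i) o\<^sub>L W i = real_diag (weight i)"
  by (rule blinfun_ell2_eqI)
     (simp add: coord_cadjoint_W coord_W coord_real_diag bounded_weight of_real_sqrt_weight_power2
       flip: mult.assoc)

lemma W_compose_cadjoint_W: "W i o\<^sub>L cadjoint (W i) = real_diag (co_weight i)"
  by (rule blinfun_ell2_eqI)
     (simp add: coord_cadjoint_W coord_W coord_real_diag [OF bounded_co_weight] of_real_sqrt_weight_power2
       co_weight_def flip: mult.assoc split: list.split)

text \<open>This rule and the next supply the commutation hypothesis of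
  \<open>intertwines_transport\<close>, for adding and for removing a letter.\<close>

lemma ket_proj_compose_W: "ket_proj ((#) i ` G) o\<^sub>L W i = W i o\<^sub>L ket_proj G"
  by (rule blinfun_ell2_eqI)
     (auto simp: coord_W coord_ket_proj split: list.split)

lemma ket_proj_compose_cadjoint_W: "ket_proj {\<alpha>. i # \<alpha> \<in> G} o\<^sub>L cadjoint (W i) = cadjoint (W i) o\<^sub>L ket_proj G"
  by (rule blinfun_ell2_eqI) (simp add: coord_cadjoint_W coord_ket_proj)

end

text \<open>Interpreted with a given extension \<phi>, and also with the identity map to learn which
  projections lie in the algebra.\<close>

locale weighted_fock_cp_extension = weighted_fock b + unital_cp_ell2 "cstar (range (weighted_left_creation b))" \<phi>
  for b :: "'n::finite list \<Rightarrow> real" and \<phi> :: "('n fock \<Rightarrow>\<^sub>L 'n fock) \<Rightarrow> ('n fock \<Rightarrow>\<^sub>L 'n fock)" +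
  assumes phi_W: "\<phi> (W i) = W i"
begin

lemma W_in: "W i \<in> cstar (range W)"
  using subset_cstar [of "range W"] by blast

lemma phi_cadjoint_W: "\<phi> (cadjoint (W i)) = cadjoint (W i)"
proof (intro blinfun_eqI cinner_left_eqI)
  fix x y
  show "cinner (blinfun_apply (\<phi> (cadjoint (W i))) x) y = cinner (blinfun_apply (cadjoint (W i)) x) y"
    by (simp add: cinner_phi_cadjoint W_in phi_W cinner_cadjoint_left W_bounded_clinear)
qed

lemma cadjoint_cadjoint_W: "cadjoint (cadjoint (W i)) = W i"
  by (rule cadjoint_cadjoint [OF W_bounded_clinear])

section \<open>Removing and adding letters\<close>

lemma cadjoint_W_maximizers:
  assumes "localized G" "i # \<alpha> \<in> G"
  obtains G' c where "G' \<subseteq> G" "G' \<noteq> {}" "c > 0" "localized G'" "\<And>x. x \<in> G' \<Longrightarrow> co_weight i x = c"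
    "\<And>x. x \<in> G' \<Longrightarrow> intertwines (cadjoint (W i)) (ket x) (blinfun_apply (cadjoint (W i)) (ket x))"
proof -
  have "cadjoint (cadjoint (W i)) o\<^sub>L cadjoint (W i) = real_diag (co_weight i)"
    by (simp only: cadjoint_cadjoint_W W_compose_cadjoint_W)
  note 1 = localized_maximizers [OF adjoint [OF W_in] phi_cadjoint_W this bounded_co_weight co_weight_nonneg assms]
  have "co_weight i (i # \<alpha>) > 0" by (simp add: co_weight_def weight_pos)
  from 1 [OF this that] show thesis .
qed

text \<open>Since \<open>co_weight i\<close> is constantly \<open>c\<close> on \<open>G\<close>,
  \<open>cadjoint (W i) o\<^sub>L ket_proj G o\<^sub>L W i\<close> is \<open>c\<close> times the
  projection onto the shortened words, and \<open>cadjoint (W i)\<close> transports the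
  localization.\<close>

lemma localized_strip:
  assumes G: "localized G" and c: "c > 0" "\<And>x. x \<in> G \<Longrightarrow> co_weight i x = c"
    and int: "\<And>x. x \<in> G \<Longrightarrow> intertwines (cadjoint (W i)) (ket x) (blinfun_apply (cadjoint (W i)) (ket x))"
  shows "localized {\<alpha>. i # \<alpha> \<in> G}"
proof -
  let ?H = "{\<alpha>. i # \<alpha> \<in> G}"
  have "finite ((#) i -` G)" by (rule finite_vimageI [OF localizedD(1) [OF G]]) simp
  hence fin: "finite ?H" by (simp add: vimage_def)
  have "weight i \<alpha> = c" if "i # \<alpha> \<in> G" for \<alpha> using c(2) [OF that] by (simp add: co_weight_def)
  moreover have "complex_of_real (sqrt c) * complex_of_real (sqrt c) = complex_of_real c"
    using c(1) by (simp flip: of_real_mult)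
  ultimately have "ket_proj ?H = complex_of_real (1 / c) *\<^sub>C (cadjoint (W i) o\<^sub>L ket_proj G o\<^sub>L W i)"
    using c(1)
    by (intro blinfun_ell2_eqI)
       (auto simp: coord_ket_proj scaleC_blinfun.rep_eq scaleC_ell2.rep_eq coord_cadjoint_W coord_W
         simp flip: mult.assoc)
  hence P: "ket_proj ?H \<in> cstar (range W)"
    by (simp only:) (intro scaleC compose adjoint W_in localizedD(2) [OF G])
  have "intertwines (ket_proj ?H) (ket \<alpha>) (ket \<alpha>)" if "i # \<alpha> \<in> G" for \<alpha>
    using intertwines_transport [OF int [OF that] localizedD(3) [OF G that] P ket_proj_compose_cadjoint_W]
      sqrt_weight_neq_0 unfolding cadjoint_W_ket by (rule intertwines_scaleC_cancel)
  thus ?thesis using fin P by (simp add: localized_def)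
qed

text \<open>While some word of \<open>G\<close> begins with a letter \<open>i\<close>, pass to the
  maximizers of \<open>co_weight i\<close>, which all begin with \<open>i\<close>, and strip that
  letter. The total size decreases, so the process ends, and it can end only at the empty
  word.\<close>

lemma localized_Nil:
  assumes "localized G" "G \<noteq> {}"
  shows "localized {[]}"
  using assms
proof (induction "\<Sum>\<gamma>\<in>G. Suc (length \<gamma>)" arbitrary: G rule: less_induct)
  case less
  note finG = localizedD(1) [OF less.prems(1)]
  show ?case
  proof (cases "G = {[]}")
    case False
    then obtain i \<alpha> where "i # \<alpha> \<in> G" using less.prems(2) by (metis is_singletonI' is_singleton_the_elem list.exhaust singleton_iff)
    obtain G' c where G': "G' \<subseteq> G" "G' \<noteq> {}" "c > 0" "localized G'"
        "\<And>x. x \<in> G' \<Longrightarrow> co_weight i x = c"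
        "\<And>x. x \<in> G' \<Longrightarrow> intertwines (cadjoint (W i)) (ket x) (blinfun_apply (cadjoint (W i)) (ket x))"
      by (rule cadjoint_W_maximizers [OF less.prems(1) \<open>i # \<alpha> \<in> G\<close>], rule that)
    let ?H = "{\<alpha>. i # \<alpha> \<in> G'}"
    have start: "\<exists>\<alpha>. x = i # \<alpha>" if "x \<in> G'" for x
      using G'(5) [OF that] G'(3) by (auto simp: co_weight_def split: list.splits if_splits)
    have H: "localized ?H" by (rule localized_strip [OF G'(4,3,5,6)])
    have "?H \<noteq> {}" using G'(2) start by blast
    have "(\<Sum>\<gamma>\<in>?H. Suc (length \<gamma>)) < (\<Sum>\<gamma>\<in>?H. Suc (length (i # \<gamma>)))"
      using \<open>?H \<noteq> {}\<close> localizedD(1) [OF H] by (intro sum_strict_mono) auto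
    also have "\<dots> = (\<Sum>\<gamma>\<in>(#) i ` ?H. Suc (length \<gamma>))" by (subst sum.reindex) auto
    also have "\<dots> \<le> (\<Sum>\<gamma>\<in>G. Suc (length \<gamma>))"
      using G'(1) finG by (intro sum_mono2) auto
    finally show ?thesis using less.hyps [of ?H] H \<open>?H \<noteq> {}\<close> by blast
  qed (use less.prems in simp)
qed

text \<open>On a single word every weight is trivially maximal.\<close>

lemma localized_singleton_intertwines:
  assumes "localized {\<alpha>}"
  shows "intertwines (W i) (ket \<alpha>) (blinfun_apply (W i) (ket \<alpha>))"
    and "intertwines (cadjoint (W i)) (ket \<alpha>) (blinfun_apply (cadjoint (W i)) (ket \<alpha>))"
  by (rule localized_norm_attained [OF W_in phi_W cadjoint_W_compose_W bounded_weight assms]; simp)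
     (rule localized_norm_attained [OF adjoint [OF W_in] phi_cadjoint_W _ bounded_co_weight assms];
      simp add: cadjoint_cadjoint_W W_compose_cadjoint_W)

text \<open>\<open>W i o\<^sub>L ket_proj {\<alpha>} o\<^sub>L cadjoint (W i)\<close> is a positive
  multiple of the projection onto the longer word, and \<open>W i\<close> transports the
  localization.\<close>

lemma localized_Cons:
  assumes "localized {\<alpha>}" shows "localized {i # \<alpha>}"
proof -
  have "ket_proj {i # \<alpha>} = complex_of_real (1 / weight i \<alpha>) *\<^sub>C (W i o\<^sub>L ket_proj {\<alpha>} o\<^sub>L cadjoint (W i))"
    using weight_pos [of i \<alpha>] of_real_sqrt_weight_power2 [of i \<alpha>]
    by (intro blinfun_ell2_eqI)
       (auto simp: coord_ket_proj scaleC_blinfun.rep_eq scaleC_ell2.rep_eq coord_cadjoint_W coord_W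
         simp flip: mult.assoc split: list.split)
  hence P: "ket_proj {i # \<alpha>} \<in> cstar (range W)"
    by (simp only:) (intro scaleC compose adjoint W_in localizedD(2) [OF assms])
  have "ket_proj {i # \<alpha>} o\<^sub>L W i = W i o\<^sub>L ket_proj {\<alpha>}"
    using ket_proj_compose_W [of i "{\<alpha>}"] by simp
  hence "intertwines (ket_proj {i # \<alpha>}) (blinfun_apply (W i) (ket \<alpha>)) (blinfun_apply (W i) (ket \<alpha>))"
    using P by (intro intertwines_transport [OF localized_singleton_intertwines(1) [OF assms] localizedD(3) [OF assms]]) simp_all
  hence "intertwines (ket_proj {i # \<alpha>}) (ket (i # \<alpha>)) (ket (i # \<alpha>))"
    using sqrt_weight_neq_0 unfolding W_ket by (rule intertwines_scaleC_cancel)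
  thus ?thesis using P by (simp add: localized_def)
qed

lemma localized_singleton:
  assumes "localized G" "G \<noteq> {}"
  shows "localized {\<alpha>}"
  by (induction \<alpha>) (simp_all add: localized_Nil [OF assms] localized_Cons)

lemma phi_eq_id:
  assumes "localized G" "G \<noteq> {}" "a \<in> cstar (range W)"
  shows "\<phi> a = a"
proof (rule eq_id_if_right_multipliers [OF refl _ assms(3)])
  fix w assume "w \<in> range W"
  then obtain i where "w = W i" by blast
  thus "right_multiplier w \<and> right_multiplier (cadjoint w)"
    using localized_singleton_intertwines [OF localized_singleton [OF assms(1,2)]]
    by (simp add: right_multiplier_if_intertwines_kets W_in adjoint)
qed

text \<open>The starting point: the symbol \<open>s\<close> of the sum of all
  \<open>cadjoint (W i) o\<^sub>L W i\<close> has an isolated maximum \<open>c\<close>, attained on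
  finitely many words.\<close>

lemma ex_localized:
  defines "s \<equiv> \<lambda>\<gamma>. \<Sum>i\<in>UNIV. weight i \<gamma>"
  assumes fin: "finite {\<gamma>. s \<gamma> > m}" and m: "m \<ge> 0" and ex: "s \<gamma>\<^sub>0 > m"
  shows "\<exists>G. localized G \<and> G \<noteq> {}"
proof -
  obtain c d where cd: "m \<le> d" "d < c" "\<And>\<gamma>. s \<gamma> = c \<or> s \<gamma> \<le> d"
      "finite {\<gamma>. s \<gamma> = c}" "\<exists>\<gamma>. s \<gamma> = c"
    by (rule finite_superlevel_gap [OF fin ex], rule that)
  define G where "G = {\<gamma>. s \<gamma> = c}"
  have bs: "bounded (range s)" unfolding s_def by (intro bounded_range_sum bounded_weight)
  have T: "(\<Sum>i\<in>UNIV. cadjoint (W i) o\<^sub>L W i) = real_diag s"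
    unfolding cadjoint_W_compose_W s_def by (rule real_diag_sum [OF bounded_weight])
  have WW: "cadjoint (W i) o\<^sub>L W i \<in> cstar (range W)" for i by (intro compose adjoint W_in)
  have s: "real_diag s \<in> cstar (range W)" unfolding T [symmetric] by (intro sum WW)
  have s0: "0 \<le> s \<gamma>" for \<gamma> unfolding s_def by (intro sum_nonneg) (simp add: weight_pos less_imp_le)
  have P: "ket_proj G \<in> cstar (range W)"
    unfolding G_def by (rule ket_proj_level_set [OF cstar s s0 _ cd(2,3)]) (use m cd in linarith)
  have "intertwines (ket_proj G) (ket \<gamma>) (ket \<gamma>)" if \<gamma>: "\<gamma> \<in> G" for \<gamma>
  \<comment> \<open>The squeeze starts from all words, whose projection is the identity and is
    preserved by \<phi>.\<close>
  proof (rule intertwines_ket_proj_squeeze [of UNIV G])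
    let ?r = "\<lambda>x. c * 1 - s x"
    show "bounded (range ?r)" by (intro bounded_range_intros bs)
    have r: "real_diag ?r = complex_of_real c *\<^sub>C id_blinfun - real_diag s"
      by (simp only: real_diag_diff [symmetric] real_diag_scale [symmetric] real_diag_one bounded_range_intros bs)
    thus "real_diag ?r \<in> cstar (range W)" by (simp only: diff scaleC id s)
    \<comment> \<open>Schwarz for each letter, with \<open>\<phi> (W i) = W i\<close>, keeps the
      expectation of \<phi> of the sum at least at the maximal value \<open>c\<close>.\<close>
    have "c = (\<Sum>i\<in>UNIV. weight i \<gamma>)" using \<gamma> by (simp add: G_def s_def)
    also have "\<dots> = (\<Sum>i\<in>UNIV. (norm (blinfun_apply (W i) (ket \<gamma>)))\<^sup>2)"
      unfolding W_ket using weight_pos by (simp add: less_imp_le)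
    also have "\<dots> \<le> (\<Sum>i\<in>UNIV. Re (cinner (blinfun_apply (\<phi> (cadjoint (W i) o\<^sub>L W i)) (ket \<gamma>)) (ket \<gamma>)))"
    proof (rule sum_mono)
      fix i
      have "Re (cinner (blinfun_apply (W i) (ket \<gamma>)) (blinfun_apply (W i) (ket \<gamma>))) = (norm (blinfun_apply (W i) (ket \<gamma>)))\<^sup>2"
        by (simp only: cinner_self Re_complex_of_real)
      thus "(norm (blinfun_apply (W i) (ket \<gamma>)))\<^sup>2 \<le> Re (cinner (blinfun_apply (\<phi> (cadjoint (W i) o\<^sub>L W i)) (ket \<gamma>)) (ket \<gamma>))"
        using schwarz_defect_nonneg [OF W_in, of i "ket \<gamma>" "blinfun_apply (W i) (ket \<gamma>)"]
        unfolding phi_W by linarith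
    qed
    also have "\<dots> = Re (cinner (blinfun_apply (\<phi> (real_diag s)) (ket \<gamma>)) (ket \<gamma>))"
      unfolding T [symmetric] by (simp add: phi_sum WW blinfun.sum_left cinner_sum_left)
    finally show "Re (cinner (blinfun_apply (\<phi> (real_diag ?r)) (ket \<gamma>)) (ket \<gamma>)) \<le> 0"
      unfolding r by (simp add: phi_diff scaleC id s phi_scaleC unit blinfun.diff_left cinner_diff_left
          scaleC_blinfun.rep_eq cinner_self)
    show "c - d > 0" using cd by simp
    show "(c - d) * (indicator UNIV x - indicator G x) \<le> ?r x" for x
      using cd(3) [of x] by (auto simp: indicator_def G_def)
  qed (simp_all add: real_diag_one id unit P)
  moreover have "G \<noteq> {}" using cd(5) by (auto simp: G_def)
  ultimately show ?thesis using cd(4) P by (auto simp: localized_def G_def)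
qed

end

text \<open>A nonzero coordinate and its projection put one basis vector into \<open>M\<close>; the
  adjoints lead down to the empty word, and the \<open>W i\<close> from there to every word.\<close>

lemma (in weighted_fock) W_invariant_subspace_trivial:
  assumes M: "csubspace M" "closed M" "\<And>T. T \<in> cstar (range W) \<Longrightarrow> blinfun_apply T ` M \<subseteq> M"
    and P: "\<And>\<alpha>. ket_proj {\<alpha>} \<in> cstar (range W)" and x: "x \<in> M" "x \<noteq> 0"
  shows "M = UNIV"
proof -
  have ucs: "unital_cstar_algebra (cstar (range W))"
    using W_bounded_clinear by (intro unital_cstar_algebra_cstar) blast
  have WB: "W i \<in> cstar (range W)" for i using subset_cstar [of "range W"] by blast
  have cancel: "y \<in> M" if "s *\<^sub>C y \<in> M" "s \<noteq> 0" for s y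
    using complex_vector.subspace_scale [OF M(1) that(1), of "inverse s"] that(2) by simp
  obtain \<alpha> where \<alpha>: "coord x \<alpha> \<noteq> 0"
    using x(2) ell2_eqI [of x 0] by (auto simp: zero_ell2.rep_eq)
  have "blinfun_apply (ket_proj {\<alpha>}) x = coord x \<alpha> *\<^sub>C ket \<alpha>"
    by (rule ell2_eqI) (simp add: coord_ket_proj scaleC_ell2.rep_eq ket.rep_eq)
  moreover have "blinfun_apply (ket_proj {\<alpha>}) x \<in> M" using M(3) [OF P] x(1) by blast
  ultimately have "ket \<alpha> \<in> M" using cancel \<alpha> by metis
  hence Nil: "ket [] \<in> M"
  proof (induction \<alpha>)
    case (Cons i \<alpha>)
    have "cadjoint (W i) \<in> cstar (range W)" using ucs WB by (simp add: unital_cstar_algebra_def)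
    hence "blinfun_apply (cadjoint (W i)) (ket (i # \<alpha>)) \<in> M" using M(3) Cons.prems by blast
    thus ?case using Cons.IH cancel sqrt_weight_neq_0 by (simp add: cadjoint_W_ket)
  qed
  have "ket \<beta> \<in> M" for \<beta>
  proof (induction \<beta>)
    case (Cons i \<beta>)
    have "blinfun_apply (W i) (ket \<beta>) \<in> M" using M(3) [OF WB] Cons.IH by blast
    thus ?case using cancel sqrt_weight_neq_0 by (metis W_ket)
  qed (rule Nil)
  thus ?thesis by (rule closed_csubspace_kets_UNIV [OF M(1,2)])
qed

section \<open>Irreducibility and uniqueness of the extension\<close>

lemma completely_positive_id:
  assumes "unital_cstar_algebra B" shows "completely_positive B (\<lambda>T. T)"
  using assms by (simp add: completely_positive_def linear_on_algebra_def unital_cstar_algebra_def)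

theorem theorem6p2:
  fixes b :: "'n::finite list \<Rightarrow> real"
  assumes "b [] = 1" and "\<And>\<alpha>. b \<alpha> > 0" and "free_holomorphic_at_0 b"
    and "\<And>i. bdd_above (range (\<lambda>\<alpha>. b \<alpha> / b (i # \<alpha>)))"
    and "\<exists>i. \<forall>p. ((\<lambda>\<gamma>. b (p # \<gamma>) / b (i # p # \<gamma>) - b \<gamma> / b (p # \<gamma>)) \<longlongrightarrow> 0) words_at_infinity"
    and "\<exists>L. ((\<lambda>\<gamma>. \<Sum>i\<in>UNIV. b \<gamma> / b (i # \<gamma>)) \<longlongrightarrow> L) words_at_infinity
             \<and> L < (SUP \<gamma>. \<Sum>i\<in>UNIV. b \<gamma> / b (i # \<gamma>))"
  shows "boundary_property (weighted_left_creation b)"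
proof -
  interpret weighted_fock b by unfold_locales (fact assms(2), fact assms(4))
  let ?B = "cstar (range W)" and ?S = "cspan (insert id_blinfun (range W))"
  define s where "s = (\<lambda>\<gamma>. \<Sum>i\<in>UNIV. weight i \<gamma>)"
  obtain L where L: "(s \<longlongrightarrow> L) words_at_infinity" "L < (SUP \<gamma>. s \<gamma>)"
    using assms(6) by (auto simp: s_def weight_def)
  have bs: "bounded (range s)" unfolding s_def by (intro bounded_range_sum bounded_weight)
  have s0: "0 \<le> s \<gamma>" for \<gamma> unfolding s_def by (intro sum_nonneg) (simp add: weight_pos less_imp_le)
  obtain \<gamma>\<^sub>0 where "L < s \<gamma>\<^sub>0"
    using L(2) less_cSUP_iff [of UNIV s L] bounded_imp_bdd_above [OF bs] by auto
  \<comment> \<open>The midpoint lies strictly between \<open>L\<close> and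
    \<open>s \<gamma>\<^sub>0\<close>, and taking \<open>max L 0\<close> makes it nonnegative, as
    \<open>ex_localized\<close> demands.\<close>
  define m where "m = (max L 0 + s \<gamma>\<^sub>0) / 2"
  have "s \<gamma>\<^sub>0 > 0" unfolding s_def by (intro sum_pos) (simp_all add: weight_pos)
  hence m: "L < m" "0 \<le> m" "m < s \<gamma>\<^sub>0" using \<open>L < s \<gamma>\<^sub>0\<close> s0 [of \<gamma>\<^sub>0] by (auto simp: m_def)
  \<comment> \<open>Beyond some length \<open>s\<close> stays below \<open>m\<close>; as the
    alphabet is finite, only finitely many words exceed \<open>m\<close>.\<close>
  have "\<forall>\<^sub>F \<gamma> in words_at_infinity. s \<gamma> < m" by (rule order_tendstoD(2) [OF L(1) m(1)])
  then obtain N where N: "\<And>\<gamma>. length \<gamma> \<ge> N \<Longrightarrow> s \<gamma> < m"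
    by (auto simp: words_at_infinity_def eventually_filtercomap eventually_at_top_linorder)
  have words: "finite {\<gamma> :: 'n list. length \<gamma> \<le> N}" using finite_lists_length_le [of "UNIV :: 'n set" N] by simp
  have "length \<gamma> \<le> N" if "s \<gamma> > m" for \<gamma> using N [of \<gamma>] that by (meson less_asym nat_le_linear)
  hence fin: "finite {\<gamma>. s \<gamma> > m}" by (intro finite_subset [OF _ words]) auto

  have WR: "range W \<subseteq> bounded_clinear_ops" using W_bounded_clinear by blast
  note B = unital_cstar_algebra_cstar [OF WR]
  have cp_id: "completely_positive ?B (\<lambda>T. T)" by (rule completely_positive_id [OF B])
  have ext: "weighted_fock_cp_extension b \<phi>"
    if "completely_positive ?B \<phi>" "\<phi> id_blinfun = id_blinfun" "\<And>i. \<phi> (W i) = W i" for \<phi>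
    by unfold_locales (use that B in auto)

  \<comment> \<open>For the identity map, localization of single words says that the projections
    onto basis vectors lie in the algebra, which yields irreducibility.\<close>
  interpret id: weighted_fock_cp_extension b "\<lambda>T. T" by (rule ext [OF cp_id]) simp_all
  obtain G where "id.localized G" "G \<noteq> {}"
    using id.ex_localized [of m \<gamma>\<^sub>0] fin m unfolding s_def by blast
  hence P: "ket_proj {\<alpha>} \<in> ?B" for \<alpha> using id.localized_singleton id.localizedD(2) by blast
  have irr: "irreducible_representation ?B (\<lambda>T. T)"
    unfolding irreducible_representation_def
  proof (intro conjI allI impI)
    show "star_representation ?B (\<lambda>T. T)"
      using cp_id by (simp add: star_representation_def completely_positive_def)
    have "ket [] \<noteq> (0 :: 'n fock)" by (metis norm_ket norm_zero zero_neq_one)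
    thus "(UNIV :: 'n fock set) \<noteq> {0}" by blast
    fix M :: "'n fock set"
    assume M: "csubspace M \<and> closed M \<and> (\<forall>T\<in>?B. blinfun_apply T ` M \<subseteq> M)"
    show "M = {0} \<or> M = UNIV"
    proof (cases "\<exists>x\<in>M. x \<noteq> 0")
      case True
      thus ?thesis using W_invariant_subspace_trivial [of M] M P by blast
    next
      case False
      moreover have "0 \<in> M" using M complex_vector.subspace_0 by blast
      ultimately show ?thesis by blast
    qed
  qed
  \<comment> \<open>A competing extension fixes the unit and every \<open>W i\<close>, so it has a
    localized set as well and must be the identity.\<close>
  have "\<phi> T = T" if \<phi>: "completely_positive ?B \<phi>" "\<forall>T\<in>?S. \<phi> T = T" and T: "T \<in> ?B" for \<phi> T
  proof -
    have "insert id_blinfun (range W) \<subseteq> ?S" by (rule complex_vector.span_superset)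
    hence "\<phi> id_blinfun = id_blinfun" "\<phi> (W i) = W i" for i using \<phi>(2) by auto
    then interpret weighted_fock_cp_extension b \<phi> by (intro ext \<phi>(1))
    obtain G where "localized G" "G \<noteq> {}"
      using ex_localized [of m \<gamma>\<^sub>0] fin m unfolding s_def by blast
    thus ?thesis using T by (rule phi_eq_id)
  qed
  moreover have "csubspace ?S" by (rule complex_vector.subspace_span)
  moreover have "id_blinfun \<in> ?S" by (rule complex_vector.span_base) simp
  moreover have "?B = cstar ?S" by (rule cstar_cspan_insert_id [OF WR, symmetric])
  ultimately show ?thesis
    unfolding boundary_property_def boundary_representation_def
    by (intro conjI allI impI ballI B irr cp_id) simp_all
qed

end
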